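(* Let $U\subset\mathbb S$ be a patch and let $r>1$ be fixed. There exists no continuous function $\Phi:\mathbb R_+\to\mathbb R_+$ with $\lim_{\varepsilon\to0}\Phi(\varepsilon)=0$ such that $$\|\mathbf f_+\|_{L^2(\mathbb S)^3}+\|\mathbf f_-\|_{L^2(\mathbb S)^3}\le\Phi\Big(\|(\mathbf f_++\mathbf f_-)|_U\|_{L^2(U)^3}\Big)\quad\text{for all }\mathbf f_+\in\mathcal H_+^{(r)}(\mathbb S),\ \mathbf f_-\in\mathcal H_-(\mathbb S).$$
   Context: $\mathbb R_+=[0,\infty)$. $\mathbb{S}=\{x\in\mathbb R^3:|x|=1\}$ is the unit sphere, with outward unit normal $\eta(x)=x$ and surface gradient $\nabla_{\mathbb S}$; $\mathbb S_r=\{|x|=r\}$ and $\mathbb B_r=\{|x|<r\}$ in $\mathbb R^3$. A patch $U$ is a non-empty open subregion of $\mathbb{S}$ with connected Lipschitz boundary such that $V=\mathbb{S}\setminus\overline U$ is non-empty. Let $\{Y_{n,k}\}_{n\ge 0,\,|k|\le n}$ be an orthonormal basis of $L^2(\mathbb{S})$ of scalar spherical harmonics ($Y_{n,k}$ of degree $n$) and set $$\mathbf G^{\mathrm{ext}}_{n,k}=\nabla_{\mathbb S}Y_{n,k}+n\,\eta Y_{n,k},\qquad \mathbf G^{\mathrm{int}}_{n,k}=\nabla_{\mathbb S}Y_{n,k}-(n+1)\,\eta Y_{n,k}.$$ The Hardy spaces are the closed subspaces of $L^2(\mathbb S)^3$ $$\mathcal H_+(\mathbb S)=\overline{\mathrm{span}\{\mathbf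 G^{\mathrm{ext}}_{n,k}:n\ge1,|k|\le n\}}^{L^2(\mathbb S)^3},\qquad \mathcal H_-(\mathbb S)=\overline{\mathrm{span}\{\mathbf G^{\mathrm{int}}_{n,k}:n\ge0,|k|\le n\}}^{L^2(\mathbb S)^3}.$$ Equivalently, $\mathcal H_+(\mathbb S)$ (resp. $\mathcal H_-(\mathbb S)$) consists of the nontangential boundary limits $\nabla u|_{\mathbb S}$ of gradients of functions $u$ harmonic in the open unit ball (resp. harmonic in the complement of the closed unit ball with $u(x)\to0$ as $|x|\to\infty$) such that the nontangential maximal function of $\nabla u$ on $\mathbb S$, taken from the respective side, is square-integrable. For $r>1$, the external-source altitude class is $$\mathcal H_+^{(r)}(\mathbb S)=\{\nabla u|_{\mathbb S}:\ \Delta u=0\text{ in }\mathbb B_r,\ \|(\nabla u)_+^M\|_{L^2(\mathbb S_r)^3}<\infty,\ u|_{\mathbb S_r}\in H^1(\mathbb S_r)\}\subset\mathcal H_+(\mathbb S),$$ where $(\nabla u)^M_+$ denotes the nontangential maximal function of $\nabla u$ on $\mathbb S_r$ taken from inside $\mathbb B_r$, and $u|_{\mathbb S_r}$ the boundary trace. *)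

theory Defs
  imports "HOL-Analysis.Analysis"
begin

text \<open>
  Surface measure on the sphere of radius \<open>r > 0\<close>: the cone over a patch of area \<open>A\<close> with apex at
  the origin has volume \<open>r A / 3\<close>, so area is \<open>3 / r\<close> times the pushforward of volume on the
  punctured ball under radial projection.
\<close>

definition sphere_measure :: "real \<Rightarrow> (real^3) measure" where
  "sphere_measure r = scale_measure (ennreal (3 / r))
     (distr (restrict_space lborel (ball 0 r - {0})) (restrict_space borel (sphere 0 r))
        (\<lambda>x. (r / norm x) *\<^sub>R x))"

lemma space_sphere_measure [simp]: "space (sphere_measure r) = sphere 0 r"
  by (simp add: sphere_measure_def space_scale_measure space_restrict_space)

lemma sets_sphere_measure [measurable_cong]:
  "sets (sphere_measure r) = sets (restrict_space borel (sphere 0 r))"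
  by (simp add: sphere_measure_def)

lemma measurable_radial_projection:
  assumes "r > 0"
  shows "(\<lambda>x::real^3. (r / norm x) *\<^sub>R x) \<in>
    restrict_space lborel (ball 0 r - {0}) \<rightarrow>\<^sub>M restrict_space borel (sphere 0 r)"
  by (rule measurable_restrict_space3) (use assms in \<open>auto simp: dist_norm\<close>)

lemma emeasure_sphere_measure:
  assumes "r > 0" and "A \<in> sets (sphere_measure r)"
  shows "emeasure (sphere_measure r) A =
    ennreal (3 / r) * emeasure lborel {x \<in> ball 0 r - {0}. (r / norm x) *\<^sub>R x \<in> A}"
proof -
  have A: "A \<in> sets (restrict_space borel (sphere 0 r))"
    using assms(2) by (simp add: sets_sphere_measure)
  have eq: "(\<lambda>x. (r / norm x) *\<^sub>R x) -` A \<inter> (ball 0 r - {0}) =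
      {x \<in> ball 0 r - {0}. (r / norm x) *\<^sub>R x \<in> A}"
    by auto
  show ?thesis
    unfolding sphere_measure_def
    by (simp add: emeasure_distr[OF measurable_radial_projection[OF assms(1)] A]
        space_restrict_space emeasure_restrict_space eq Collect_conj_eq)
      (subst emeasure_restrict_space; auto)
qed

lemma emeasure_sphere_measure_sphere:
  assumes "r > 0"
  shows "emeasure (sphere_measure r) (sphere 0 r) = ennreal (4 * pi * r\<^sup>2)"
proof -
  have "sphere 0 r \<in> sets (sphere_measure r)"
    using sets.top[of "sphere_measure r"] by simp
  from assms this have "emeasure (sphere_measure r) (sphere 0 r) =
      ennreal (3 / r) * emeasure lborel {x \<in> ball (0::real^3) r - {0}. (r / norm x) *\<^sub>R x \<in> sphere 0 r}"
    by (rule emeasure_sphere_measure)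
  also have "{x \<in> ball (0::real^3) r - {0}. (r / norm x) *\<^sub>R x \<in> sphere 0 r} = ball 0 r - {0}"
    using assms by auto
  also have "emeasure lborel (ball (0::real^3) r - {0}) = emeasure lborel (ball (0::real^3) r)"
    using assms by (subst emeasure_Diff) auto
  also have "\<dots> = ennreal (4 / 3 * pi * r ^ 3)"
    using assms by (subst emeasure_ball) (auto simp: unit_ball_vol_3)
  also have "ennreal (3 / r) * \<dots> = ennreal (4 * pi * r\<^sup>2)"
    using assms by (simp add: ennreal_mult[symmetric] power2_eq_square power3_eq_cube)
  finally show ?thesis .
qed

definition L2_space :: "'a measure \<Rightarrow> ('a \<Rightarrow> 'b::real_normed_vector) set" where
  "L2_space M = {f \<in> borel_measurable M. integrable M (\<lambda>x. (norm (f x))\<^sup>2)}"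

text \<open>Only meaningful for functions in \<^const>\<open>L2_space\<close>: a non-integrable square gives the value 0.\<close>

definition L2_norm :: "'a measure \<Rightarrow> ('a \<Rightarrow> 'b::real_normed_vector) \<Rightarrow> real" where
  "L2_norm M f = sqrt (\<integral>x. (norm (f x))\<^sup>2 \<partial>M)"

text \<open>Closure in \<open>L\<^sup>2(M)\<close> of the linear span of a family of functions in \<open>L\<^sup>2(M)\<close>.\<close>

definition L2_closed_span ::
    "'a measure \<Rightarrow> 'i set \<Rightarrow> ('i \<Rightarrow> 'a \<Rightarrow> 'b::real_normed_vector) \<Rightarrow> ('a \<Rightarrow> 'b) set" where
  "L2_closed_span M I g = {f \<in> L2_space M. \<forall>\<epsilon>>0. \<exists>F c. finite F \<and> F \<subseteq> I \<and>
     L2_norm M (\<lambda>x. f x - (\<Sum>i\<in>F. c i *\<^sub>R g i x)) < \<epsilon>}"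

definition gradient :: "('a::euclidean_space \<Rightarrow> real) \<Rightarrow> 'a \<Rightarrow> 'a" where
  "gradient u x = (THE D. GDERIV u x :> D)"

definition laplacian :: "('a::euclidean_space \<Rightarrow> real) \<Rightarrow> 'a \<Rightarrow> real" where
  "laplacian u x = (\<Sum>b\<in>Basis. frechet_derivative (gradient u) (at x) b \<bullet> b)"

definition C1_on :: "'a::euclidean_space set \<Rightarrow> ('a \<Rightarrow> real) \<Rightarrow> bool" where
  "C1_on S u \<longleftrightarrow> (\<forall>x\<in>S. u differentiable (at x)) \<and> continuous_on S (gradient u)"

definition C2_on :: "'a::euclidean_space set \<Rightarrow> ('a \<Rightarrow> real) \<Rightarrow> bool" where
  "C2_on S u \<longleftrightarrow> C1_on S u \<and> (\<forall>x\<in>S. gradient u differentiable (at x)) \<and>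
     (\<forall>h. continuous_on S (\<lambda>x. frechet_derivative (gradient u) (at x) h))"

definition harmonic_on :: "'a::euclidean_space set \<Rightarrow> ('a \<Rightarrow> real) \<Rightarrow> bool" where
  "harmonic_on S u \<longleftrightarrow> C2_on S u \<and> (\<forall>x\<in>S. laplacian u x = 0)"

text \<open>
  Functions on the sphere of radius \<open>r\<close> are represented by functions on the whole space of which
  only the values on the sphere matter.  Their surface gradient is the gradient of the extension
  that is constant along rays; at points of the sphere it is automatically tangential.
\<close>

definition radial_extension :: "real \<Rightarrow> (real^3 \<Rightarrow> real) \<Rightarrow> real^3 \<Rightarrow> real" where
  "radial_extension r f x = f ((r / norm x) *\<^sub>R x)"

definition surface_gradient :: "real \<Rightarrow> (real^3 \<Rightarrow> real) \<Rightarrow> real^3 \<Rightarrow> real^3" where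
  "surface_gradient r f x = gradient (radial_extension r f) x"

definition spherical_harmonic :: "nat \<Rightarrow> (real^3 \<Rightarrow> real) \<Rightarrow> bool" where
  "spherical_harmonic n f \<longleftrightarrow> (\<exists>p. real_polynomial_function p \<and>
     (\<forall>t x. p (t *\<^sub>R x) = t ^ n * p x) \<and> harmonic_on UNIV p \<and> (\<forall>x\<in>sphere 0 1. f x = p x))"

definition harmonic_indices :: "nat \<Rightarrow> (nat \<times> int) set" where
  "harmonic_indices n0 = {(n, k). n0 \<le> n \<and> \<bar>k\<bar> \<le> int n}"

definition spherical_harmonic_basis :: "(nat \<Rightarrow> int \<Rightarrow> real^3 \<Rightarrow> real) \<Rightarrow> bool" where
  "spherical_harmonic_basis Y \<longleftrightarrow>
     (\<forall>(n, k)\<in>harmonic_indices 0. spherical_harmonic n (Y n k)) \<and>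
     (\<forall>(n, k)\<in>harmonic_indices 0. \<forall>(m, l)\<in>harmonic_indices 0.
        (\<integral>x. Y n k x * Y m l x \<partial>sphere_measure 1) = (if n = m \<and> k = l then 1 else 0)) \<and>
     L2_closed_span (sphere_measure 1) (harmonic_indices 0) (\<lambda>(n, k). Y n k)
       = L2_space (sphere_measure 1)"

text \<open>The outward unit normal of the unit sphere at \<open>x\<close> is \<open>x\<close> itself.\<close>

definition G_int :: "(nat \<Rightarrow> int \<Rightarrow> real^3 \<Rightarrow> real) \<Rightarrow> nat \<Rightarrow> int \<Rightarrow> real^3 \<Rightarrow> real^3" where
  "G_int Y n k x = surface_gradient 1 (Y n k) x - ((real n + 1) * Y n k x) *\<^sub>R x"

definition Hardy_minus :: "(nat \<Rightarrow> int \<Rightarrow> real^3 \<Rightarrow> real) \<Rightarrow> (real^3 \<Rightarrow> real^3) set" where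
  "Hardy_minus Y =
     L2_closed_span (sphere_measure 1) (harmonic_indices 0) (\<lambda>(n, k). G_int Y n k)"

text \<open>
  Nontangential approach region at \<open>x\<close> on the sphere of radius \<open>r\<close>, from inside, with aperture
  parameter \<open>\<alpha> > 0\<close>.
\<close>

definition nt_region :: "real \<Rightarrow> real \<Rightarrow> real^3 \<Rightarrow> (real^3) set" where
  "nt_region \<alpha> r x = {y \<in> ball 0 r. dist x y < (1 + \<alpha>) * infdist y (sphere 0 r)}"

definition nt_maximal :: "real \<Rightarrow> real \<Rightarrow> (real^3 \<Rightarrow> real^3) \<Rightarrow> real^3 \<Rightarrow> ennreal" where
  "nt_maximal \<alpha> r F x = (SUP y\<in>nt_region \<alpha> r x. ennreal (norm (F y)))"

definition nt_trace :: "real \<Rightarrow> real \<Rightarrow> (real^3 \<Rightarrow> real) \<Rightarrow> (real^3 \<Rightarrow> real) \<Rightarrow> bool" where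
  "nt_trace \<alpha> r u g \<longleftrightarrow>
     (AE x in sphere_measure r. (u \<longlongrightarrow> g x) (at x within nt_region \<alpha> r x))"

text \<open>
  \<open>H\<^sup>1\<close> of the sphere of radius \<open>r\<close>, as the completion of the \<open>C\<^sup>1\<close> functions on the sphere in the
  norm that combines the \<open>L\<^sup>2\<close> norms of a function and of its surface gradient; \<open>G\<close> is the weak
  surface gradient of \<open>g\<close>.
\<close>

definition H1_sphere :: "real \<Rightarrow> (real^3 \<Rightarrow> real) set" where
  "H1_sphere r = {g \<in> L2_space (sphere_measure r). \<exists>G\<in>L2_space (sphere_measure r).
     \<forall>\<epsilon>>0. \<exists>\<phi>. C1_on (- {0}) (radial_extension r \<phi>) \<and>
       L2_norm (sphere_measure r) (\<lambda>x. g x - \<phi> x) < \<epsilon> \<and>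
       L2_norm (sphere_measure r) (\<lambda>x. G x - surface_gradient r \<phi> x) < \<epsilon>}"

definition Hardy_plus_altitude :: "real \<Rightarrow> real \<Rightarrow> (real^3 \<Rightarrow> real^3) set" where
  "Hardy_plus_altitude \<alpha> r = {f \<in> L2_space (sphere_measure 1). \<exists>u.
     harmonic_on (ball 0 r) u \<and>
     (\<integral>\<^sup>+x. (nt_maximal \<alpha> r (gradient u) x)\<^sup>2 \<partial>sphere_measure r) < \<infinity> \<and>
     (\<exists>g\<in>H1_sphere r. nt_trace \<alpha> r u g) \<and>
     (AE x in sphere_measure 1. f x = gradient u x)}"

text \<open>
  Near each boundary point \<open>p\<close>, in the coordinates given by orthogonal projection onto the tangent
  plane at \<open>p\<close> with a suitable orthonormal frame \<open>e\<^sub>1, e\<^sub>2\<close>, the set is the part of the sphere above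
  a Lipschitz graph.
\<close>

definition Lipschitz_boundary :: "(real^3) set \<Rightarrow> bool" where
  "Lipschitz_boundary U \<longleftrightarrow> (\<forall>p \<in> (top_of_set (sphere 0 1)) frontier_of U.
     \<exists>e\<^sub>1 e\<^sub>2 \<gamma> L \<delta>. norm e\<^sub>1 = 1 \<and> norm e\<^sub>2 = 1 \<and> e\<^sub>1 \<bullet> e\<^sub>2 = 0 \<and> e\<^sub>1 \<bullet> p = 0 \<and> e\<^sub>2 \<bullet> p = 0 \<and>
       L-lipschitz_on (UNIV :: real set) \<gamma> \<and> \<delta> > 0 \<and>
       (\<forall>x\<in>sphere 0 1 \<inter> ball p \<delta>. x \<in> U \<longleftrightarrow> x \<bullet> e\<^sub>2 > \<gamma> (x \<bullet> e\<^sub>1)))"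

definition patch :: "(real^3) set \<Rightarrow> bool" where
  "patch U \<longleftrightarrow> U \<noteq> {} \<and> openin (top_of_set (sphere 0 1)) U \<and> connected U \<and>
     connected ((top_of_set (sphere 0 1)) frontier_of U) \<and> Lipschitz_boundary U \<and>
     sphere 0 1 - closure U \<noteq> {}"

end

theory Submission
  imports Defs
begin

text \<open>
  The pair \<open>f\<^sub>+ = 0\<close>, \<open>f\<^sub>- = \<nabla>u\<close> already defeats stability when \<open>u\<close> is an exterior harmonic
  function that is concentrated, on the sphere, at a point \<open>v\<close> away from \<open>U\<close>. For orthonormal \<open>v\<close>
  and \<open>b\<close> put \<open>z = x \<bullet> v + \<i> (x \<bullet> b)\<close>. The powers \<open>z^n\<close> are harmonic, so
  \<open>Re (P (z / |x|^2)) / |x|\<close> is harmonic outside the origin for every polynomial \<open>P\<close>. Taking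
  \<open>P = ((1 + z) / 2)^N\<close>, whose modulus on the closed unit disc peaks at \<open>z = 1\<close>, that is at
  \<open>x = v\<close>, the gradient is exponentially smaller on \<open>U\<close> than near \<open>v\<close>.

  These gradients lie in the span of the \<open>G_int Y n k\<close> for any basis \<open>Y\<close>, because spherical harmonics
  of different degrees are orthogonal: the rotation generators are skew-adjoint, and the sum of their
  squares is \<open>- n (n + 1)\<close> on degree \<open>n\<close>.
\<close>

subsection \<open>The surface measure\<close>

abbreviation unit_sphere :: "(real^3) set" where
  "unit_sphere \<equiv> sphere 0 1"

abbreviation \<sigma> :: "(real^3) measure" where
  "\<sigma> \<equiv> sphere_measure 1"

lemma finite_measure_\<sigma>: "finite_measure \<sigma>"
  by (rule finite_measureI) (simp add: emeasure_sphere_measure_sphere)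

lemma borel_measurable_\<sigma>:
  fixes f :: "real^3 \<Rightarrow> 'b::topological_space"
  assumes "continuous_on unit_sphere f"
  shows "f \<in> borel_measurable \<sigma>"
  using borel_measurable_continuous_on_restrict[OF assms]
  by (simp add: measurable_cong_sets[OF sets_sphere_measure refl])

lemma integrable_\<sigma>:
  fixes f :: "real^3 \<Rightarrow> 'b::{banach, second_countable_topology}"
  assumes "continuous_on unit_sphere f"
  shows "integrable \<sigma> f"
proof -
  have "bounded (f ` unit_sphere)"
    using assms by (intro compact_imp_bounded compact_continuous_image) auto
  then obtain B where "\<And>x. x \<in> unit_sphere \<Longrightarrow> norm (f x) \<le> B"
    unfolding bounded_iff by blast
  then show ?thesis
    by (intro finite_measure.integrable_const_bound[OF finite_measure_\<sigma>, of _ B]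
        borel_measurable_\<sigma> assms AE_I2) simp
qed

lemma L2_space_\<sigma>:
  assumes "continuous_on unit_sphere f"
  shows "f \<in> L2_space \<sigma>"
  unfolding L2_space_def using assms
  by (auto intro!: borel_measurable_\<sigma> integrable_\<sigma> continuous_intros)

lemma sets_\<sigma>_openin:
  assumes "openin (top_of_set unit_sphere) A"
  shows "A \<in> sets \<sigma>"
proof -
  obtain T where "open T" "A = T \<inter> unit_sphere"
    using assms by (auto simp: openin_open)
  then show ?thesis
    by (auto simp: sets_sphere_measure sets_restrict_space)
qed

text \<open>The cone over \<open>A\<close> in the punctured ball is open and non-empty, so it has
  positive volume. This gives mass both to the sets where a continuous function does not vanish and
  to neighbourhoods of the peak.\<close>

lemma emeasure_\<sigma>_openin_pos:
  assumes "openin (top_of_set unit_sphere) A" "A \<noteq> {}"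
  shows "emeasure \<sigma> A > 0"
proof -
  obtain W where W: "open W" "A = W \<inter> unit_sphere"
    using assms by (auto simp: openin_open)
  define T where "T = {x \<in> ball (0::real^3) 1 - {0}. (1 / norm x) *\<^sub>R x \<in> A}"
  have T: "T = (ball 0 1 - {0}) \<inter> (\<lambda>x. (1 / norm x) *\<^sub>R x) -` W"
    by (auto simp: T_def W)
  have "open T"
    unfolding T by (intro continuous_open_preimage continuous_intros) (auto simp: W(1))
  moreover have "T \<noteq> {}"
  proof -
    obtain w where "w \<in> A" using assms by auto
    then have "norm w = 1" using W by auto
    with \<open>w \<in> A\<close> have "(1/2) *\<^sub>R w \<in> T" by (auto simp: T_def)
    then show ?thesis by auto
  qed
  ultimately have "\<not> negligible T" by (rule open_not_negligible)
  then have "emeasure lborel T \<noteq> 0"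
    using \<open>open T\<close> by (auto simp: negligible_iff_null_sets null_sets_def)
  moreover have "emeasure \<sigma> A = 3 * emeasure lborel T"
    unfolding T_def by (subst emeasure_sphere_measure) (auto intro: sets_\<sigma>_openin assms)
  ultimately show ?thesis
    by (simp add: zero_less_iff_neq_zero)
qed

text \<open>A point where \<open>f\<close> is non-zero lies in a relatively open set of such points,
  which has positive measure. Equalities in the mean between continuous functions thereby become
  pointwise.\<close>

lemma continuous_L2_\<sigma>_zero:
  fixes f :: "real^3 \<Rightarrow> real"
  assumes "continuous_on unit_sphere f" "(\<integral>x. (f x)\<^sup>2 \<partial>\<sigma>) = 0" "x \<in> unit_sphere"
  shows "f x = 0"
proof (rule ccontr)
  assume "f x \<noteq> 0"
  define A where "A = unit_sphere \<inter> f -` (- {0})"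
  have A: "openin (top_of_set unit_sphere) A"
    unfolding A_def by (rule continuous_openin_preimage_gen) (use assms in auto)
  have "AE x in \<sigma>. (f x)\<^sup>2 = 0"
    using assms by (subst integral_nonneg_eq_0_iff_AE[symmetric])
      (auto intro!: integrable_\<sigma> continuous_intros)
  then have "emeasure \<sigma> {x \<in> space \<sigma>. f x \<noteq> 0} = 0"
    by (intro emeasure_eq_0_AE) auto
  also have "{x \<in> space \<sigma>. f x \<noteq> 0} = A"
    by (auto simp: A_def)
  finally have "emeasure \<sigma> A = 0" .
  moreover have "x \<in> A"
    using \<open>f x \<noteq> 0\<close> assms(3) by (simp add: A_def)
  ultimately show False
    using emeasure_\<sigma>_openin_pos[OF A] by auto
qed

section \<open>Rotation invariance and differentiation along rotations\<close>

text \<open>Boundedness makes \<open>B\<close> an \<open>lmeasurable\<close> set, where invariance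
  of the real-valued \<open>measure\<close> under orthogonal maps applies; finiteness carries the
  equality over to \<open>emeasure\<close>.\<close>

lemma emeasure_lborel_orthogonal_vimage:
  fixes R :: "real^3 \<Rightarrow> real^3"
  assumes R: "orthogonal_transformation R" and "B \<in> sets borel" "bounded B"
  shows "emeasure lborel (R -` B) = emeasure lborel B"
proof -
  have R': "orthogonal_transformation (inv R)" "bij R"
    using R orthogonal_transformation_inv orthogonal_transformation_bij by auto
  have eq: "R -` B = inv R ` B"
    using R'(2) by (simp add: bij_vimage_eq_inv_image)
  have cont: "continuous_on UNIV R"
    using R by (simp add: linear_continuous_on orthogonal_transformation_linear linear_conv_bounded_linear[symmetric])
  have meas: "R -` B \<in> sets borel"
    using measurable_sets[OF borel_measurable_continuous_onI[OF cont] assms(2)] by simp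
  have B: "B \<in> lmeasurable"
    using assms by (intro bounded_set_imp_lmeasurable) auto
  have "measure lebesgue (inv R ` B) = measure lebesgue B" "inv R ` B \<in> lmeasurable"
    using measure_orthogonal_image[OF R'(1) B] measurable_orthogonal_image[OF R'(1) B] by auto
  then have "emeasure lebesgue (inv R ` B) = emeasure lebesgue B"
    using B by (simp add: emeasure_eq_measure2 fmeasurableD2)
  then show ?thesis
    using meas assms(2) by (simp add: eq)
qed

text \<open>Radial projection commutes with orthogonal maps, so the cone over the preimage of
  \<open>A\<close> is the preimage of the cone over \<open>A\<close>. Invariance of volume then
  gives invariance of \<sigma>.\<close>

lemma distr_\<sigma>_orthogonal:
  fixes R :: "real^3 \<Rightarrow> real^3"
  assumes R: "orthogonal_transformation R"
  shows "distr \<sigma> \<sigma> R = \<sigma>"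
proof (rule measure_eqI)
  fix A assume "A \<in> sets (distr \<sigma> \<sigma> R)"
  then have A: "A \<in> sets \<sigma>" by simp
  have lin: "linear R" and norm: "\<And>x. norm (R x) = norm x"
    using R by (auto simp: orthogonal_transformation)
  have cont: "continuous_on X R" for X
    using lin by (simp add: linear_continuous_on linear_conv_bounded_linear)
  have "R \<in> \<sigma> \<rightarrow>\<^sub>M restrict_space borel unit_sphere"
    using borel_measurable_\<sigma>[OF cont] norm by (intro measurable_restrict_space2) auto
  then have meas: "R \<in> \<sigma> \<rightarrow>\<^sub>M \<sigma>"
    by (simp add: measurable_cong_sets[OF refl sets_sphere_measure])
  have A': "A \<subseteq> unit_sphere" using sets.sets_into_space[OF A] by simp
  define B where "B = {x \<in> ball (0::real^3) 1 - {0}. (1 / norm x) *\<^sub>R x \<in> A}"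
  have B: "B \<in> sets borel"
  proof -
    have "(\<lambda>x. (1 / norm x) *\<^sub>R x) -` A \<inter> space (restrict_space lborel (ball 0 1 - {0})) \<in>
        sets (restrict_space lborel (ball (0::real^3) 1 - {0}))"
      using A by (intro measurable_sets[OF measurable_radial_projection]) (auto simp: sets_sphere_measure)
    also have "(\<lambda>x. (1 / norm x) *\<^sub>R x) -` A \<inter> space (restrict_space lborel (ball 0 1 - {0})) = B"
      by (auto simp: B_def space_restrict_space)
    finally show ?thesis by (subst (asm) sets_restrict_space_iff) auto
  qed
  have "emeasure (distr \<sigma> \<sigma> R) A = emeasure \<sigma> (R -` A \<inter> unit_sphere)"
    using meas A by (simp add: emeasure_distr)
  also have "\<dots> = 3 * emeasure lborel {x \<in> ball 0 1 - {0}. (1 / norm x) *\<^sub>R x \<in> R -` A \<inter> unit_sphere}"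
    using measurable_sets[OF meas A] by (subst emeasure_sphere_measure) auto
  also have "{x \<in> ball 0 1 - {0}. (1 / norm x) *\<^sub>R x \<in> R -` A \<inter> unit_sphere} = R -` B"
    using norm A' by (auto simp: B_def linear_scale[OF lin] linear_0[OF lin])
  also have "emeasure lborel (R -` B) = emeasure lborel B"
    using R B by (intro emeasure_lborel_orthogonal_vimage bounded_subset[OF bounded_ball[of 0 1]])
      (auto simp: B_def)
  also have "3 * emeasure lborel B = emeasure \<sigma> A"
    unfolding B_def using A by (subst emeasure_sphere_measure) auto
  finally show "emeasure (distr \<sigma> \<sigma> R) A = emeasure \<sigma> A" .
qed simp

text \<open>Rodrigues' formula: for a unit vector \<open>a\<close>, the rotation by the angle
  \<open>t\<close> about the axis \<open>a\<close>.\<close>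

definition rotation :: "real^3 \<Rightarrow> real \<Rightarrow> real^3 \<Rightarrow> real^3" where
  "rotation a t x = (a \<bullet> x) *\<^sub>R a + cos t *\<^sub>R (x - (a \<bullet> x) *\<^sub>R a) + sin t *\<^sub>R cross3 a x"

lemma rotation_0 [simp]: "rotation a 0 x = x"
  by (simp add: rotation_def)

lemma orthogonal_transformation_rotation:
  assumes "norm a = 1"
  shows "orthogonal_transformation (rotation a t)"
  unfolding orthogonal_transformation
proof (intro conjI allI)
  show "linear (rotation a t)"
    by (rule linearI) (simp_all add: rotation_def inner_add_right cross_add_right
        cross_mult_right algebra_simps)
  fix x
  have a: "a \<bullet> a = 1" using assms by (simp add: norm_eq_1)
  have c: "cross3 a x \<bullet> cross3 a x = x \<bullet> x - (a \<bullet> x)\<^sup>2"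
    using norm_cross[of a x] assms by (simp add: power2_norm_eq_inner)
  have "rotation a t x \<bullet> rotation a t x =
      (a \<bullet> x)\<^sup>2 + (cos t)\<^sup>2 * (x \<bullet> x - (a \<bullet> x)\<^sup>2) + (sin t)\<^sup>2 * (x \<bullet> x - (a \<bullet> x)\<^sup>2)"
    by (simp add: rotation_def inner_add_left inner_add_right inner_diff_left inner_diff_right
        dot_cross_self a c inner_commute power2_eq_square algebra_simps)
  also have "\<dots> = (a \<bullet> x)\<^sup>2 + ((cos t)\<^sup>2 + (sin t)\<^sup>2) * (x \<bullet> x - (a \<bullet> x)\<^sup>2)"
    by (simp only: distrib_right add.assoc)
  also have "\<dots> = x \<bullet> x" by simp
  finally show "norm (rotation a t x) = norm x"
    by (simp add: norm_eq_sqrt_inner)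
qed

text \<open>\<open>rotation a\<close> is the flow of the linear field \<open>cross3 a\<close>: the
  axial part is annihilated, and the Lagrange identity reduces the double cross product.\<close>

lemma has_vector_derivative_rotation:
  assumes "norm a = 1"
  shows "((\<lambda>t. rotation a t x) has_vector_derivative cross3 a (rotation a t x)) (at t)"
proof -
  have a: "a \<bullet> a = 1" using assms by (simp add: norm_eq_1)
  have "cross3 a (rotation a t x) = - sin t *\<^sub>R (x - (a \<bullet> x) *\<^sub>R a) + cos t *\<^sub>R cross3 a x"
    by (simp add: rotation_def cross_add_right cross_mult_right Cross3.right_diff_distrib Lagrange a
        scaleR_diff_right)
  moreover have "((\<lambda>t. rotation a t x) has_vector_derivative
      - sin t *\<^sub>R (x - (a \<bullet> x) *\<^sub>R a) + cos t *\<^sub>R cross3 a x) (at t)"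
    unfolding rotation_def by (auto intro!: derivative_eq_intros)
  ultimately show ?thesis by simp
qed

text \<open>By invariance the integral of \<open>f\<close> over rotated points is independent of the
  angle; its derivative at angle 0 is the integral in question. Applied to products, this is the
  skew-adjointness of the rotation generators.\<close>

lemma integral_rotation_derivative:
  fixes f :: "real^3 \<Rightarrow> real"
  assumes a: "norm a = 1"
    and f: "\<And>x. (f has_derivative f' x) (at x)"
    and cont: "continuous_on unit_sphere (\<lambda>x. f' x (cross3 a x))"
  shows "(\<integral>x. f' x (cross3 a x) \<partial>\<sigma>) = 0"
proof -
  note R = orthogonal_transformation_rotation[OF a]
  have norm: "norm (rotation a t x) = norm x" for t x
    using R by (simp add: orthogonal_transformation)
  have cf: "continuous_on X f" for X
    using f by (meson continuous_at_imp_continuous_on has_derivative_continuous)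
  have cR: "continuous_on X (rotation a t)" for X t
    using R[of t] by (simp add: orthogonal_transformation_linear linear_continuous_on linear_conv_bounded_linear[symmetric])
  have d: "((\<lambda>t. f (rotation a t x)) has_real_derivative
      f' (rotation a t x) (cross3 a (rotation a t x))) (at t)" for x t
    using diff_chain_at[OF has_vector_derivative_rotation[OF a, unfolded has_vector_derivative_def] f]
    by (simp add: o_def has_field_derivative_def linear_scale[OF has_derivative_linear[OF f]] mult_commute_abs)
  have "bounded ((\<lambda>x. f' x (cross3 a x)) ` unit_sphere)"
    using cont by (intro compact_imp_bounded compact_continuous_image) auto
  then obtain M where M: "\<And>x. x \<in> unit_sphere \<Longrightarrow> \<bar>f' x (cross3 a x)\<bar> \<le> M"
    unfolding bounded_iff real_norm_def by blast
  \<comment> \<open>A sequence of angles tending to 0, so that dominated convergence applies to the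
    difference quotients \<open>q\<close>.\<close>
  define t where "t n = 1 / real (Suc n)" for n
  have t: "t n > 0" for n by (simp add: t_def)
  define q where "q n x = (f (rotation a (t n) x) - f x) / t n" for n x
  have inv: "(\<integral>x. f (rotation a s x) \<partial>\<sigma>) = (\<integral>x. f x \<partial>\<sigma>)" for s
  proof -
    have "rotation a s \<in> \<sigma> \<rightarrow>\<^sub>M restrict_space borel unit_sphere"
      using borel_measurable_\<sigma>[OF cR] norm by (intro measurable_restrict_space2) auto
    then have "rotation a s \<in> \<sigma> \<rightarrow>\<^sub>M \<sigma>"
      by (simp add: measurable_cong_sets[OF refl sets_sphere_measure])
    then have "(\<integral>x. f (rotation a s x) \<partial>\<sigma>) = (\<integral>x. f x \<partial>distr \<sigma> \<sigma> (rotation a s))"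
      by (intro integral_distr[symmetric] borel_measurable_\<sigma> cf)
    then show ?thesis by (simp add: distr_\<sigma>_orthogonal[OF R])
  qed
  have int: "integrable \<sigma> (\<lambda>x. f (rotation a s x))" for s
    by (intro integrable_\<sigma> continuous_on_compose2[OF cf cR]) auto
  have "(\<integral>x. q n x \<partial>\<sigma>) = 0" for n
    using int[of "t n"] int[of 0] by (simp add: q_def inv)
  moreover have "(\<lambda>n. \<integral>x. q n x \<partial>\<sigma>) \<longlonglongrightarrow> (\<integral>x. f' x (cross3 a x) \<partial>\<sigma>)"
  proof (rule integral_dominated_convergence[where w = "\<lambda>_. M"])
    show "(\<lambda>x. f' x (cross3 a x)) \<in> borel_measurable \<sigma>"
      by (rule borel_measurable_\<sigma>[OF cont])
    show "q n \<in> borel_measurable \<sigma>" for n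
      unfolding q_def by (intro borel_measurable_\<sigma> continuous_intros continuous_on_compose2[OF cf cR] cf)
         (use t[of n] in auto)
    show "integrable \<sigma> (\<lambda>_. M)" by (intro integrable_\<sigma> continuous_intros)
    show "AE x in \<sigma>. (\<lambda>n. q n x) \<longlonglongrightarrow> f' x (cross3 a x)"
    proof (rule AE_I2)
      fix x
      have "((\<lambda>h. (f (rotation a h x) - f x) / h) \<longlongrightarrow> f' x (cross3 a x)) (at 0)"
        using d[of x 0] by (simp add: DERIV_def)
      moreover have "filterlim t (at 0) sequentially"
        unfolding filterlim_at t_def using LIMSEQ_Suc[OF lim_1_over_n] by auto
      ultimately show "(\<lambda>n. q n x) \<longlonglongrightarrow> f' x (cross3 a x)"
        unfolding q_def by (rule filterlim_compose)
    qed
    show "AE x in \<sigma>. norm (q n x) \<le> M" for n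
    proof (rule AE_I2)
      fix x assume "x \<in> space \<sigma>"
      then have x: "norm x = 1" by simp
      \<comment> \<open>Mean value theorem: the quotient is a derivative at a rotated point, which
        is still on the sphere, so \<open>M\<close> dominates it.\<close>
      obtain s where "f (rotation a (t n) x) - f (rotation a 0 x) =
          (t n - 0) * f' (rotation a s x) (cross3 a (rotation a s x))"
        using MVT2[OF t[of n] d] by blast
      then have "q n x = f' (rotation a s x) (cross3 a (rotation a s x))"
        using t[of n] by (simp add: q_def field_simps)
      then show "norm (q n x) \<le> M"
        using M[of "rotation a s x"] norm x by simp
    qed
  qed
  ultimately show ?thesis
    by (simp add: LIMSEQ_const_iff)
qed

subsection \<open>Orthogonality of spherical harmonics\<close>

lemma gradient_eqI: "GDERIV u x :> D \<Longrightarrow> gradient u x = D"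
  unfolding gradient_def gderiv_def
  by (rule the_equality)
    (auto dest: has_derivative_unique simp: fun_eq_iff vector_eq_ldot)

lemma GDERIV_gradient:
  assumes "u differentiable (at x)"
  shows "GDERIV u x :> gradient u x"
proof -
  obtain f' where f': "(u has_derivative f') (at x)"
    using assms by (auto simp: differentiable_def)
  have "f' = (\<lambda>h. h \<bullet> (\<Sum>b\<in>Basis. f' b *\<^sub>R b))"
  proof
    fix h
    have "f' h = f' (\<Sum>b\<in>Basis. (h \<bullet> b) *\<^sub>R b)"
      by (simp add: euclidean_representation)
    also have "\<dots> = (\<Sum>b\<in>Basis. (h \<bullet> b) * f' b)"
      using has_derivative_linear[OF f'] by (simp add: linear_sum linear_scale)
    also have "\<dots> = h \<bullet> (\<Sum>b\<in>Basis. f' b *\<^sub>R b)"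
      by (simp add: inner_sum_right mult.commute)
    finally show "f' h = h \<bullet> (\<Sum>b\<in>Basis. f' b *\<^sub>R b)" .
  qed
  then have "GDERIV u x :> (\<Sum>b\<in>Basis. f' b *\<^sub>R b)"
    using f' unfolding gderiv_def by metis
  then show ?thesis by (metis gradient_eqI)
qed

lemma sum_Basis_3:
  fixes f :: "real^3 \<Rightarrow> 'b::comm_monoid_add"
  shows "(\<Sum>b\<in>Basis. f b) = f (axis 1 1) + f (axis 2 1) + f (axis 3 1)"
proof -
  have "Basis = range (\<lambda>i::3. axis i (1::real))"
    by (auto simp: Basis_vec_def)
  moreover have "inj (\<lambda>i::3. axis i (1::real))"
    by (auto simp: inj_def axis_eq_axis)
  ultimately show ?thesis
    using sum.reindex[of "\<lambda>i::3. axis i (1::real)" UNIV f] by (simp only: sum_3 o_def)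
qed

section \<open>Homogeneous harmonic functions and the rotation generators\<close>

text \<open>Gradient \<open>g\<close> and Hessian \<open>H\<close> are explicit data, so that the
  same lemmas serve the abstract derivatives of spherical harmonics and the closed formulas for
  powers of a complex coordinate. The last conjunct is Laplace's equation, as a vanishing
  trace.\<close>

definition harmonic_jet ::
    "nat \<Rightarrow> (real^3 \<Rightarrow> real) \<Rightarrow> (real^3 \<Rightarrow> real^3) \<Rightarrow> (real^3 \<Rightarrow> real^3 \<Rightarrow> real^3) \<Rightarrow> bool" where
  "harmonic_jet n p g H \<longleftrightarrow>
     (\<forall>t x. p (t *\<^sub>R x) = t ^ n * p x) \<and>
     (\<forall>x. GDERIV p x :> g x) \<and> (\<forall>x. (g has_derivative H x) (at x)) \<and>
     (\<forall>h. continuous_on UNIV (\<lambda>x. H x h)) \<and> (\<forall>x. (\<Sum>b\<in>Basis. H x b \<bullet> b) = 0)"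

lemma harmonic_jetI:
  assumes "harmonic_on UNIV p" "\<And>t x. p (t *\<^sub>R x) = t ^ n * p x"
  shows "harmonic_jet n p (gradient p) (\<lambda>x. frechet_derivative (gradient p) (at x))"
  using assms
  by (auto simp: harmonic_jet_def harmonic_on_def C2_on_def C1_on_def laplacian_def
      frechet_derivative_works[symmetric] GDERIV_gradient)

text \<open>Euler's identity, from differentiating the homogeneity relation at
  \<open>t = 1\<close>.\<close>

lemma inner_gradient_homogeneous:
  assumes hom: "\<And>t x. p (t *\<^sub>R x) = t ^ n * p x" and "GDERIV p x :> g"
  shows "x \<bullet> g = real n * p x"
proof -
  have "((\<lambda>t. p (t *\<^sub>R x)) has_derivative (\<lambda>s. (s *\<^sub>R x) \<bullet> g)) (at 1)"
    using assms(2) unfolding gderiv_def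
    by (intro has_derivative_compose[of "\<lambda>t. t *\<^sub>R x" _ 1 UNIV p]) (auto intro!: derivative_eq_intros)
  then have "((\<lambda>t. t ^ n * p x) has_derivative (\<lambda>s. s * (x \<bullet> g))) (at 1)"
    by (simp add: hom)
  moreover have "((\<lambda>t. t ^ n * p x) has_derivative (\<lambda>s. s * (real n * p x))) (at (1::real))"
    by (auto intro!: derivative_eq_intros simp: algebra_simps)
  ultimately have "(\<lambda>s. s * (x \<bullet> g)) = (\<lambda>s. s * (real n * p x))"
    by (rule has_derivative_unique)
  then show ?thesis by (metis mult_1)
qed

text \<open>The three rotation generators square to the Laplace-Beltrami operator on the sphere.\<close>

lemma harmonic_jet_casimir:
  assumes "harmonic_jet n p g H" "x \<in> unit_sphere"
  shows "(\<Sum>a\<in>Basis. cross3 a (cross3 a x) \<bullet> g x + cross3 a x \<bullet> H x (cross3 a x)) =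
    - (real n * (real n + 1)) * p x"
proof -
  have hom: "\<And>t x. p (t *\<^sub>R x) = t ^ n * p x" and G: "\<And>x. GDERIV p x :> g x"
    and H: "\<And>x. (g has_derivative H x) (at x)" and tr: "\<And>x. (\<Sum>b\<in>Basis. H x b \<bullet> b) = 0"
    using assms by (auto simp: harmonic_jet_def)
  have x: "x \<bullet> x = 1" using assms(2) by (simp add: norm_eq_1)
  have euler: "y \<bullet> g y = real n * p y" for y
    using inner_gradient_homogeneous[OF hom G] .
  \<comment> \<open>Differentiating Euler's identity once more, in the direction \<open>x\<close>,
    determines the radial second derivative \<open>x \<bullet> H x x\<close>.\<close>
  have "((\<lambda>y. y \<bullet> g y) has_derivative (\<lambda>h. x \<bullet> H x h + h \<bullet> g x)) (at x)"
    using H by (auto intro!: derivative_eq_intros)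
  moreover have "((\<lambda>y. y \<bullet> g y) has_derivative (\<lambda>h. real n * (h \<bullet> g x))) (at x)"
    using G[of x] unfolding euler gderiv_def by (auto intro!: derivative_eq_intros)
  ultimately have "(\<lambda>h. x \<bullet> H x h + h \<bullet> g x) = (\<lambda>h. real n * (h \<bullet> g x))"
    by (rule has_derivative_unique)
  then have euler2: "x \<bullet> H x x + x \<bullet> g x = real n * (x \<bullet> g x)"
    by metis
  have lin: "linear (H x)" using has_derivative_linear[OF H] .
  define e1 e2 e3 :: "real^3" where "e1 = axis 1 1" and "e2 = axis 2 1" and "e3 = axis 3 1"
  note e = e1_def e2_def e3_def
  have xe: "x = x$1 *\<^sub>R e1 + x$2 *\<^sub>R e2 + x$3 *\<^sub>R e3"
    using exhaust_3 by (force simp: e axis_def vec_eq_iff)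
  have sq: "x$1 * x$1 + x$2 * x$2 + x$3 * x$3 = 1"
    using x by (simp add: inner_vec_def sum_3)
  have c: "cross3 e1 x = x$2 *\<^sub>R e3 - x$3 *\<^sub>R e2" "cross3 e2 x = x$3 *\<^sub>R e1 - x$1 *\<^sub>R e3"
      "cross3 e3 x = x$1 *\<^sub>R e2 - x$2 *\<^sub>R e1"
    by (simp_all add: e vec_eq_iff forall_3 cross_components axis_def)
  have "H x x = H x (x$1 *\<^sub>R e1 + x$2 *\<^sub>R e2 + x$3 *\<^sub>R e3)"
    using arg_cong[OF xe, of "H x"] .
  also have "\<dots> = x$1 *\<^sub>R H x e1 + x$2 *\<^sub>R H x e2 + x$3 *\<^sub>R H x e3"
    by (simp add: linear_add[OF lin] linear_scale[OF lin])
  finally have Hx: "x \<bullet> H x x = (x$1 *\<^sub>R e1 + x$2 *\<^sub>R e2 + x$3 *\<^sub>R e3) \<bullet>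
      (x$1 *\<^sub>R H x e1 + x$2 *\<^sub>R H x e2 + x$3 *\<^sub>R H x e3)"
    using arg_cong[OF xe, of "\<lambda>y. y \<bullet> H x x"] by simp
  have tr': "e1 \<bullet> H x e1 + e2 \<bullet> H x e2 + e3 \<bullet> H x e3 = 0"
    using tr[of x] by (simp add: sum_Basis_3 e inner_commute)
  \<comment> \<open>The outer products of the vectors \<open>cross3 a x\<close> with themselves add
    up to \<open>|x|^2 I - x x^T\<close>. Hence the sum is \<open>|x|^2\<close> times the trace of
    \<open>H x\<close>, which is 0, minus \<open>x \<bullet> H x x\<close>.\<close>
  have quad: "(\<Sum>a\<in>Basis. cross3 a x \<bullet> H x (cross3 a x)) = - (x \<bullet> H x x)"
  proof -
    have "(\<Sum>a\<in>Basis. cross3 a x \<bullet> H x (cross3 a x)) + x \<bullet> H x x =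
        (x$1 * x$1 + x$2 * x$2 + x$3 * x$3) * (e1 \<bullet> H x e1 + e2 \<bullet> H x e2 + e3 \<bullet> H x e3)"
      unfolding sum_Basis_3 e[symmetric] Hx c
      by (simp add: linear_diff[OF lin] linear_scale[OF lin] inner_add_left inner_add_right
          inner_diff_left inner_diff_right algebra_simps)
    then show ?thesis using tr' by simp
  qed
  have first: "(\<Sum>a\<in>Basis. cross3 a (cross3 a x)) = - 2 *\<^sub>R x"
  proof -
    have "(\<Sum>a\<in>Basis. cross3 a (cross3 a x)) = (\<Sum>a\<in>Basis. (x \<bullet> a) *\<^sub>R a - x)"
      by (intro sum.cong refl) (simp add: Lagrange inner_commute)
    also have "\<dots> = x - 3 *\<^sub>R x"
      by (simp add: sum_subtractf euclidean_representation sum_constant_scaleR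
          del: sum_constant)
    also have "\<dots> = - 2 *\<^sub>R x"
      using scaleR_left_diff_distrib[of 1 3 x] by simp
    finally show ?thesis .
  qed
  \<comment> \<open>By the two Euler identities the right side is
    \<open>- 2 n p - n (n - 1) p\<close>, which is \<open>- n (n + 1) p\<close>.\<close>
  have "(\<Sum>a\<in>Basis. cross3 a (cross3 a x) \<bullet> g x + cross3 a x \<bullet> H x (cross3 a x)) =
      - 2 * (x \<bullet> g x) - x \<bullet> H x x"
    by (simp add: sum.distrib quad first flip: inner_sum_left)
  then show ?thesis
    using euler2 euler[of x] by (simp add: algebra_simps)
qed

text \<open>Eigenfunctions of a symmetric operator with different eigenvalues are orthogonal. The
  operator is the sum of squared rotation generators, and its symmetry is obtained axis by
  axis.\<close>

lemma spherical_harmonics_orthogonal: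
  assumes P: "harmonic_jet n p g H" and Q: "harmonic_jet m q g' H'" and "n \<noteq> m"
  shows "(\<integral>x. p x * q x \<partial>\<sigma>) = 0"
proof -
  have Gp: "\<And>x. (p has_derivative (\<lambda>h. h \<bullet> g x)) (at x)" and Gq: "\<And>x. (q has_derivative (\<lambda>h. h \<bullet> g' x)) (at x)"
    and Hp: "\<And>x. (g has_derivative H x) (at x)" and Hq: "\<And>x. (g' has_derivative H' x) (at x)"
    and cH: "\<And>h. continuous_on UNIV (\<lambda>x. H x h)" "\<And>h. continuous_on UNIV (\<lambda>x. H' x h)"
    using P Q by (auto simp: harmonic_jet_def gderiv_def)
  have cont: "continuous_on X p" "continuous_on X q" "continuous_on X g" "continuous_on X g'" for X
    using Gp Gq Hp Hq by (meson continuous_at_imp_continuous_on has_derivative_continuous)+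
  have blin: "bounded_linear (cross3 a)" for a
    unfolding linear_conv_bounded_linear[symmetric]
    by (rule linearI) (simp_all add: cross_add_right cross_mult_right)
  \<comment> \<open>A jet gives continuity of the Hessian only in fixed directions; here the
    direction moves with \<open>x\<close>, so it is expanded in the basis.\<close>
  have cont_H: "continuous_on X (\<lambda>x. K x (cross3 a x))"
    if lin: "\<And>x. linear (K x)" and c: "\<And>h. continuous_on UNIV (\<lambda>x. K x h)"
    for X a and K :: "real^3 \<Rightarrow> real^3 \<Rightarrow> real^3"
  proof -
    have "K x (cross3 a x) = (\<Sum>b\<in>Basis. (cross3 a x \<bullet> b) *\<^sub>R K x b)" for x
    proof -
      have "K x (cross3 a x) = K x (\<Sum>b\<in>Basis. (cross3 a x \<bullet> b) *\<^sub>R b)"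
        by (simp add: euclidean_representation)
      then show ?thesis using lin[of x] by (simp add: linear_sum linear_scale)
    qed
    moreover have "continuous_on X (\<lambda>x. \<Sum>b\<in>Basis. (cross3 a x \<bullet> b) *\<^sub>R K x b)"
      by (intro continuous_on_sum continuous_on_scaleR continuous_on_inner continuous_on_const
          continuous_on_subset[OF c] linear_continuous_on blin) auto
    ultimately show ?thesis by (simp only:)
  qed
  define L where "L a = (\<lambda>x. cross3 a (cross3 a x) \<bullet> g x + cross3 a x \<bullet> H x (cross3 a x))" for a
  define L' where "L' a = (\<lambda>x. cross3 a (cross3 a x) \<bullet> g' x + cross3 a x \<bullet> H' x (cross3 a x))" for a
  have cL: "continuous_on X (\<lambda>x. L a x)" "continuous_on X (\<lambda>x. L' a x)" for X a
  proof -
    have lin: "\<And>x. linear (H x)" "\<And>x. linear (H' x)"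
      using Hp Hq by (auto intro: has_derivative_linear)
    have cc: "continuous_on X (\<lambda>x. cross3 a (cross3 a x))"
      using bounded_linear_compose[OF blin blin] by (rule linear_continuous_on)
    show "continuous_on X (\<lambda>x. L a x)" "continuous_on X (\<lambda>x. L' a x)"
      unfolding L_def L'_def
      by (intro continuous_on_add continuous_on_inner cont cont_H[of H] cont_H[of H'] lin cH cc
          linear_continuous_on[OF blin])+
  qed
  have gen: "(\<integral>x. L a x * q x - p x * L' a x \<partial>\<sigma>) = 0" if "a \<in> Basis" for a
  proof -
    \<comment> \<open>With \<open>A\<close> the generator for the axis \<open>a\<close>, this is
      \<open>(A p) q - p (A q)\<close>. Applying \<open>A\<close> again, the mixed terms
      \<open>(A p) (A q)\<close> cancel and only the second-order terms \<open>L\<close> and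
      \<open>L'\<close> remain.\<close>
    define f where "f x = (cross3 a x \<bullet> g x) * q x - p x * (cross3 a x \<bullet> g' x)" for x
    define f' where "f' x h = (cross3 a x \<bullet> g x) * (h \<bullet> g' x) + (cross3 a x \<bullet> H x h + cross3 a h \<bullet> g x) * q x
        - (p x * (cross3 a x \<bullet> H' x h + cross3 a h \<bullet> g' x) + (h \<bullet> g x) * (cross3 a x \<bullet> g' x))" for x h
    have eq: "f' x (cross3 a x) = L a x * q x - p x * L' a x" for x
      by (simp add: f'_def L_def L'_def algebra_simps)
    have "(f has_derivative f' x) (at x)" for x
      unfolding f_def f'_def
      by (intro has_derivative_diff has_derivative_mult has_derivative_inner Gp Gq Hp Hq
          bounded_linear_imp_has_derivative blin)
    moreover have "continuous_on unit_sphere (\<lambda>x. f' x (cross3 a x))"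
      unfolding eq by (intro continuous_intros cont cL)
    ultimately show ?thesis
      using integral_rotation_derivative[of a f f'] that by (simp add: eq)
  qed
  have int: "integrable \<sigma> (\<lambda>x. L a x * q x - p x * L' a x)" for a
    by (intro integrable_\<sigma> continuous_intros cont cL)
  have "0 = (\<Sum>a\<in>Basis. \<integral>x. L a x * q x - p x * L' a x \<partial>\<sigma>)"
    by (simp add: gen)
  also have "\<dots> = (\<integral>x. (\<Sum>a\<in>Basis. L a x * q x - p x * L' a x) \<partial>\<sigma>)"
    by (simp add: int)
  also have "\<dots> = (\<integral>x. (real m * (real m + 1) - real n * (real n + 1)) * (p x * q x) \<partial>\<sigma>)"
  proof (rule Bochner_Integration.integral_cong[OF refl])
    fix x assume "x \<in> space \<sigma>"
    then have x: "x \<in> unit_sphere" by simp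
    have "(\<Sum>a\<in>Basis. L a x * q x - p x * L' a x) = (\<Sum>a\<in>Basis. L a x) * q x - p x * (\<Sum>a\<in>Basis. L' a x)"
      by (simp add: sum_subtractf sum_distrib_left sum_distrib_right)
    also have "\<dots> = (real m * (real m + 1) - real n * (real n + 1)) * (p x * q x)"
      by (simp add: L_def L'_def harmonic_jet_casimir[OF P x] harmonic_jet_casimir[OF Q x]
          algebra_simps)
    finally show "(\<Sum>a\<in>Basis. L a x * q x - p x * L' a x) =
        (real m * (real m + 1) - real n * (real n + 1)) * (p x * q x)" .
  qed
  also have "\<dots> = (real m * (real m + 1) - real n * (real n + 1)) * (\<integral>x. p x * q x \<partial>\<sigma>)"
    by simp
  finally have "real m * (real m + 1) - real n * (real n + 1) = 0 \<or> (\<integral>x. p x * q x \<partial>\<sigma>) = 0"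
    by simp
  moreover have "real m * (real m + 1) - real n * (real n + 1) = (real m - real n) * (real m + real n + 1)"
    by (simp add: algebra_simps)
  ultimately show ?thesis
    using \<open>n \<noteq> m\<close> by (auto simp: add_nonneg_eq_0_iff)
qed

section \<open>Surface gradients and expansion in a given basis\<close>

text \<open>At a unit vector the derivative of radial projection is the orthogonal projection onto
  the tangent plane, so only the tangential part of \<open>g\<close> survives.\<close>

lemma GDERIV_radial_extension:
  assumes p: "GDERIV p x :> g" and f: "\<And>y. y \<in> unit_sphere \<Longrightarrow> f y = p y"
    and x: "x \<in> unit_sphere"
  shows "GDERIV (radial_extension 1 f) x :> g - (x \<bullet> g) *\<^sub>R x"
proof -
  have nx: "norm x = 1" "x \<noteq> 0" using x by auto
  have "((\<lambda>y. (1 / norm y) *\<^sub>R y) has_derivative (\<lambda>h. h - (h \<bullet> x) *\<^sub>R x)) (at x)"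
    by (rule derivative_eq_intros has_derivative_norm refl)+
      (use nx in \<open>auto simp: sgn_div_norm divide_inverse\<close>)
  then have "((\<lambda>y. p ((1 / norm y) *\<^sub>R y)) has_derivative (\<lambda>h. (h - (h \<bullet> x) *\<^sub>R x) \<bullet> g)) (at x)"
    using p nx unfolding gderiv_def
    by (intro has_derivative_compose[of "\<lambda>y. (1 / norm y) *\<^sub>R y" _ x UNIV p]) auto
  then have "((\<lambda>y. p ((1 / norm y) *\<^sub>R y)) has_derivative (\<lambda>h. h \<bullet> (g - (x \<bullet> g) *\<^sub>R x))) (at x)"
    by (simp add: inner_diff_left inner_diff_right mult.commute)
  then have "(radial_extension 1 f has_derivative (\<lambda>h. h \<bullet> (g - (x \<bullet> g) *\<^sub>R x))) (at x)"
    by (rule has_derivative_transform_within_open[of _ _ _ _ "- {0}"])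
      (use nx in \<open>auto simp: radial_extension_def f\<close>)
  then show ?thesis by (simp add: gderiv_def)
qed

lemma spherical_harmonic_jet:
  assumes "spherical_harmonic n f"
  obtains p g H where "harmonic_jet n p g H" "\<And>x. x \<in> unit_sphere \<Longrightarrow> f x = p x"
  using assms harmonic_jetI unfolding spherical_harmonic_def by blast

lemma harmonic_jet_continuous:
  assumes "harmonic_jet n p g H"
  shows "continuous_on X p"
  using assms unfolding harmonic_jet_def gderiv_def
  by (meson continuous_at_imp_continuous_on has_derivative_continuous)

lemma spherical_harmonic_continuous:
  assumes "spherical_harmonic n f"
  shows "continuous_on unit_sphere f"
proof -
  obtain p g H where "harmonic_jet n p g H" "\<And>x. x \<in> unit_sphere \<Longrightarrow> f x = p x"
    using spherical_harmonic_jet[OF assms] by metis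
  then show ?thesis
    using harmonic_jet_continuous continuous_on_cong by metis
qed

text \<open>
  The difference of \<open>p\<close> and its projection to degree \<open>n\<close> is orthogonal to every \<open>Y m k\<close>, so it is
  no closer to any combination of them than to 0.
\<close>

lemma spherical_harmonic_expansion:
  assumes Y: "spherical_harmonic_basis Y" and P: "harmonic_jet n p g H"
  obtains c where "\<And>x. x \<in> unit_sphere \<Longrightarrow> p x = (\<Sum>k\<in>{- int n..int n}. c k * Y n k x)"
proof -
  define y where "y i = Y (fst i) (snd i)" for i
  have sh: "spherical_harmonic (fst i) (y i)" if "i \<in> harmonic_indices 0" for i
    using Y that by (auto simp: spherical_harmonic_basis_def y_def)
  have on: "(\<integral>x. y i x * y j x \<partial>\<sigma>) = (if i = j then 1 else 0)"
    if "i \<in> harmonic_indices 0" "j \<in> harmonic_indices 0" for i j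
    using Y that by (auto simp: spherical_harmonic_basis_def y_def prod_eq_iff split: prod.splits if_splits)
  have cy: "continuous_on unit_sphere (y i)" if "i \<in> harmonic_indices 0" for i
    using spherical_harmonic_continuous sh that by blast
  have cp: "continuous_on unit_sphere p" using harmonic_jet_continuous[OF P] .
  define K where "K = Pair n ` {- int n..int n}"
  have K: "finite K" "K \<subseteq> harmonic_indices 0" by (auto simp: K_def harmonic_indices_def)
  define c where "c i = (\<integral>x. p x * y i x \<partial>\<sigma>)" for i
  define d where "d x = p x - (\<Sum>i\<in>K. c i * y i x)" for x
  have cd: "continuous_on unit_sphere d"
    unfolding d_def using K by (intro continuous_intros cp cy) auto
  have orth: "(\<integral>x. d x * y j x \<partial>\<sigma>) = 0" if j: "j \<in> harmonic_indices 0" for j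
  proof -
    have "(\<integral>x. d x * y j x \<partial>\<sigma>) = (\<integral>x. p x * y j x - (\<Sum>i\<in>K. c i * (y i x * y j x)) \<partial>\<sigma>)"
      by (simp add: d_def algebra_simps sum_distrib_right sum_distrib_left)
    also have "\<dots> = c j - (\<integral>x. (\<Sum>i\<in>K. c i * (y i x * y j x)) \<partial>\<sigma>)"
      unfolding c_def using K j
      by (intro Bochner_Integration.integral_diff integrable_\<sigma> continuous_intros cp cy) auto
    also have "(\<integral>x. (\<Sum>i\<in>K. c i * (y i x * y j x)) \<partial>\<sigma>) = (\<Sum>i\<in>K. \<integral>x. c i * (y i x * y j x) \<partial>\<sigma>)"
      using K j by (intro Bochner_Integration.integral_sum integrable_\<sigma> continuous_intros cy) auto
    also have "\<dots> = (\<Sum>i\<in>K. if i = j then c i else 0)"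
      using K j by (intro sum.cong refl) (auto simp: on subset_iff)
    also have "\<dots> = (if j \<in> K then c j else 0)"
      using K by (simp add: sum.delta)
    also have "c j - \<dots> = 0"
    proof (cases "j \<in> K")
      \<comment> \<open>An index outside \<open>K\<close> has degree other than \<open>n\<close>, so
        its coefficient is itself 0 by orthogonality of degrees.\<close>
      case False
      then have "fst j \<noteq> n" using j by (cases j) (auto simp: K_def harmonic_indices_def abs_le_iff)
      obtain q g' H' where Q: "harmonic_jet (fst j) q g' H'" and yq: "\<And>x. x \<in> unit_sphere \<Longrightarrow> y j x = q x"
        using spherical_harmonic_jet[OF sh[OF j]] by metis
      have "c j = (\<integral>x. p x * q x \<partial>\<sigma>)"
        unfolding c_def by (intro Bochner_Integration.integral_cong) (auto simp: yq)
      then show ?thesis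
        using False spherical_harmonics_orthogonal[OF P Q] \<open>fst j \<noteq> n\<close> by auto
    qed simp
    finally show ?thesis .
  qed
  have "L2_norm \<sigma> d \<le> \<epsilon>" if "\<epsilon> > 0" for \<epsilon>
  proof -
    have "(\<lambda>(n, k). Y n k) = y" by (auto simp: fun_eq_iff y_def)
    then have "d \<in> L2_closed_span \<sigma> (harmonic_indices 0) y"
      using Y L2_space_\<sigma>[OF cd] unfolding spherical_harmonic_basis_def by metis
    then have "\<exists>F e. finite F \<and> F \<subseteq> harmonic_indices 0 \<and>
        L2_norm \<sigma> (\<lambda>x. d x - (\<Sum>i\<in>F. e i *\<^sub>R y i x)) < \<epsilon>"
      using that unfolding L2_closed_span_def mem_Collect_eq by iprover
    then obtain F e where F: "finite F" "F \<subseteq> harmonic_indices 0"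
      and less: "L2_norm \<sigma> (\<lambda>x. d x - (\<Sum>i\<in>F. e i *\<^sub>R y i x)) < \<epsilon>"
      by iprover
    define s where "s x = (\<Sum>i\<in>F. e i * y i x)" for x
    have cs: "continuous_on unit_sphere s"
      unfolding s_def using F by (intro continuous_intros cy) auto
    have "(\<integral>x. d x * s x \<partial>\<sigma>) = (\<integral>x. (\<Sum>i\<in>F. e i * (d x * y i x)) \<partial>\<sigma>)"
      by (simp add: s_def sum_distrib_left algebra_simps)
    also have "\<dots> = (\<Sum>i\<in>F. \<integral>x. e i * (d x * y i x) \<partial>\<sigma>)"
      using F by (intro Bochner_Integration.integral_sum integrable_\<sigma> continuous_intros cy cd) auto
    also have "\<dots> = 0" using F orth by (intro sum.neutral) auto
    finally have ds: "(\<integral>x. d x * s x \<partial>\<sigma>) = 0" .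
    \<comment> \<open>Pythagoras: \<open>d\<close> and \<open>s\<close> are orthogonal, so
      subtracting \<open>s\<close> cannot decrease the norm.\<close>
    have "(\<integral>x. (d x)\<^sup>2 \<partial>\<sigma>) \<le> (\<integral>x. (d x)\<^sup>2 + (s x)\<^sup>2 \<partial>\<sigma>)"
      by (intro integral_mono integrable_\<sigma> continuous_intros cd cs) auto
    also have "\<dots> = (\<integral>x. ((d x)\<^sup>2 + (s x)\<^sup>2) - 2 * (d x * s x) \<partial>\<sigma>)"
      by (subst Bochner_Integration.integral_diff)
        (auto intro!: integrable_\<sigma> continuous_intros cd cs simp: ds)
    also have "\<dots> = (\<integral>x. (norm (d x - s x))\<^sup>2 \<partial>\<sigma>)"
      by (simp add: power2_diff algebra_simps)
    finally have "L2_norm \<sigma> d \<le> L2_norm \<sigma> (\<lambda>x. d x - s x)"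
      by (simp add: L2_norm_def)
    then show ?thesis using less by (simp add: s_def)
  qed
  then have "L2_norm \<sigma> d \<le> 0" by (rule field_le_epsilon) simp
  then have "(\<integral>x. (d x)\<^sup>2 \<partial>\<sigma>) = 0"
    by (auto simp: L2_norm_def intro!: antisym Bochner_Integration.integral_nonneg)
  \<comment> \<open>Equality at every point of the sphere is what is needed to differentiate the
    expansion afterwards.\<close>
  then have d0: "d x = 0" if "x \<in> unit_sphere" for x
    using continuous_L2_\<sigma>_zero[OF cd] that by auto
  show ?thesis
  proof
    fix x assume "x \<in> unit_sphere"
    then have "p x = (\<Sum>i\<in>K. c i * y i x)" using d0 by (simp add: d_def)
    also have "\<dots> = (\<Sum>k\<in>{- int n..int n}. c (n, k) * Y n k x)"
      unfolding K_def by (subst sum.reindex) (auto simp: inj_on_def y_def)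
    finally show "p x = (\<Sum>k\<in>{- int n..int n}. c (n, k) * Y n k x)" .
  qed
qed

text \<open>The left side is the gradient on the sphere of the Kelvin transform
  \<open>p (x / |x|^2) / |x|\<close>. Euler's identity splits it into the surface gradient and
  \<open>- (n + 1) p x\<close>, both linear in \<open>p\<close>, so the expansion of
  \<open>p\<close> in degree \<open>n\<close> carries over.\<close>

lemma harmonic_jet_G_int:
  assumes Y: "spherical_harmonic_basis Y" and P: "harmonic_jet n p g H"
  obtains c where "\<And>x. x \<in> unit_sphere \<Longrightarrow>
    g x - ((2 * real n + 1) * p x) *\<^sub>R x = (\<Sum>k\<in>{- int n..int n}. c k *\<^sub>R G_int Y n k x)"
proof -
  obtain c where c: "\<And>x. x \<in> unit_sphere \<Longrightarrow> p x = (\<Sum>k\<in>{- int n..int n}. c k * Y n k x)"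
    using spherical_harmonic_expansion[OF Y P] by metis
  show ?thesis
  proof
    fix x assume x: "x \<in> unit_sphere"
    have "GDERIV (radial_extension 1 (Y n k)) x :> surface_gradient 1 (Y n k) x"
      if "k \<in> {- int n..int n}" for k
    proof -
      have "(n, k) \<in> harmonic_indices 0" using that by (auto simp: harmonic_indices_def)
      then have "spherical_harmonic n (Y n k)"
        using Y by (auto simp: spherical_harmonic_basis_def)
      then obtain q g' H' where Q: "harmonic_jet n q g' H'" and eq: "\<And>x. x \<in> unit_sphere \<Longrightarrow> Y n k x = q x"
        using spherical_harmonic_jet by metis
      have "GDERIV q x :> g' x" using Q by (auto simp: harmonic_jet_def)
      from GDERIV_radial_extension[OF this eq x] show ?thesis
        unfolding surface_gradient_def by (metis gradient_eqI)
    qed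
    then have "((\<lambda>y. \<Sum>k\<in>{- int n..int n}. c k * radial_extension 1 (Y n k) y) has_derivative
        (\<lambda>h. \<Sum>k\<in>{- int n..int n}. c k * (h \<bullet> surface_gradient 1 (Y n k) x))) (at x)"
      unfolding gderiv_def by (intro has_derivative_sum has_derivative_mult_right) auto
    then have "((\<lambda>y. \<Sum>k\<in>{- int n..int n}. c k * radial_extension 1 (Y n k) y) has_derivative
        (\<lambda>h. h \<bullet> (\<Sum>k\<in>{- int n..int n}. c k *\<^sub>R surface_gradient 1 (Y n k) x))) (at x)"
      by (simp add: inner_sum_right)
    \<comment> \<open>Extension along rays turns the identity on the sphere into one on the open set
      \<open>- {0}\<close>, where derivatives may be compared.\<close>
    then have "(radial_extension 1 p has_derivative
        (\<lambda>h. h \<bullet> (\<Sum>k\<in>{- int n..int n}. c k *\<^sub>R surface_gradient 1 (Y n k) x))) (at x)"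
      by (rule has_derivative_transform_within_open[of _ _ _ _ "- {0}"])
        (use x in \<open>auto simp: radial_extension_def c\<close>)
    then have 1: "surface_gradient 1 p x = (\<Sum>k\<in>{- int n..int n}. c k *\<^sub>R surface_gradient 1 (Y n k) x)"
      unfolding surface_gradient_def gderiv_def[symmetric] by (rule gradient_eqI)
    have Gp: "GDERIV p x :> g x" and hom: "\<And>t x. p (t *\<^sub>R x) = t ^ n * p x"
      using P by (auto simp: harmonic_jet_def)
    have "surface_gradient 1 p x = g x - (x \<bullet> g x) *\<^sub>R x"
      unfolding surface_gradient_def by (rule gradient_eqI[OF GDERIV_radial_extension[OF Gp refl x]])
    then have 2: "surface_gradient 1 p x = g x - (real n * p x) *\<^sub>R x"
      using inner_gradient_homogeneous[OF hom Gp] by simp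
    have "(\<Sum>k\<in>{- int n..int n}. c k *\<^sub>R G_int Y n k x) =
        surface_gradient 1 p x - ((real n + 1) * p x) *\<^sub>R x"
      by (simp add: 1 c[OF x] G_int_def scaleR_diff_right sum_subtractf sum_distrib_left
          scaleR_sum_left mult.left_commute)
    then show "g x - ((2 * real n + 1) * p x) *\<^sub>R x = (\<Sum>k\<in>{- int n..int n}. c k *\<^sub>R G_int Y n k x)"
      by (simp add: 2 algebra_simps flip: scaleR_add_left)
  qed
qed

subsection \<open>Peaking fields\<close>

definition zc :: "real^3 \<Rightarrow> real^3 \<Rightarrow> real^3 \<Rightarrow> complex" where
  "zc a b x = complex_of_real (x \<bullet> a) + \<i> * complex_of_real (x \<bullet> b)"

text \<open>The vector dual to the functional \<open>Re (w * zc a b h)\<close> of \<open>h\<close>,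
  whence the minus sign. For holomorphic \<open>F\<close>, the gradient of
  \<open>Re (F (zc a b x))\<close> is \<open>vc a b\<close> of the complex derivative of
  \<open>F\<close>.\<close>

definition vc :: "real^3 \<Rightarrow> real^3 \<Rightarrow> complex \<Rightarrow> real^3" where
  "vc a b w = Re w *\<^sub>R a - Im w *\<^sub>R b"

lemma inner_vc: "h \<bullet> vc a b w = Re (w * zc a b h)"
  by (simp add: vc_def zc_def inner_diff_right)

lemma norm_vc:
  assumes "norm a = 1" "norm b = 1" "a \<bullet> b = 0"
  shows "norm (vc a b w) = cmod w"
  using assms
  by (simp add: norm_eq_sqrt_inner vc_def inner_diff_left inner_diff_right inner_commute cmod_def inner_complex_def
      power2_eq_square)

text \<open>Bessel's inequality for the orthonormal pair, obtained from Cauchy-Schwarz against the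
  vector dual to the conjugate of \<open>zc a b x\<close>.\<close>

lemma cmod_zc_le:
  assumes "norm a = 1" "norm b = 1" "a \<bullet> b = 0"
  shows "cmod (zc a b x) \<le> norm x"
proof (cases "zc a b x = 0")
  case False
  have "cmod (zc a b x) * cmod (zc a b x) = Re (cnj (zc a b x) * zc a b x)"
    by (simp add: complex_norm_square[symmetric] mult.commute power2_eq_square[symmetric] del: of_real_power)
  also have "\<dots> = x \<bullet> vc a b (cnj (zc a b x))" by (simp add: inner_vc)
  also have "\<dots> \<le> norm x * norm (vc a b (cnj (zc a b x)))" by (rule norm_cauchy_schwarz)
  finally show ?thesis using False by (simp add: norm_vc[OF assms])
qed simp

lemma bounded_linear_vc: "bounded_linear (vc a b)"
  unfolding linear_conv_bounded_linear[symmetric]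
  by (rule linearI) (simp_all add: vc_def algebra_simps)

lemma bounded_linear_zc: "bounded_linear (zc a b)"
  unfolding linear_conv_bounded_linear[symmetric]
  by (rule linearI) (simp_all add: zc_def inner_add_left complex_eq_iff algebra_simps)

lemmas continuous_on_vc [continuous_intros] = bounded_linear.continuous_on[OF bounded_linear_vc]
lemmas continuous_on_zc [continuous_intros] = bounded_linear.continuous_on[OF bounded_linear_zc]

text \<open>Harmonicity holds because the complex vector \<open>a + \<i> b\<close> is isotropic.
  Where the exponents \<open>n - 1\<close> and \<open>n - 1 - 1\<close> are truncated at 0, a factor
  \<open>of_nat n\<close> or \<open>of_nat (n - 1)\<close> vanishes.\<close>

lemma harmonic_jet_power:
  assumes "norm a = 1" "norm b = 1" "a \<bullet> b = 0"
  shows "harmonic_jet n (\<lambda>x. Re (c * zc a b x ^ n))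
    (\<lambda>x. vc a b (c * (of_nat n * zc a b x ^ (n - 1))))
    (\<lambda>x h. vc a b (c * (of_nat n * (of_nat (n - 1) * (zc a b h * zc a b x ^ (n - 1 - 1))))))"
  unfolding harmonic_jet_def
proof (intro conjI allI)
  note dz = bounded_linear_imp_has_derivative[OF bounded_linear_zc]
  show "Re (c * zc a b (t *\<^sub>R x) ^ n) = t ^ n * Re (c * zc a b x ^ n)" for t x
    by (simp add: linear_scale[OF bounded_linear.linear[OF bounded_linear_zc]] scaleR_power)
  show "GDERIV (\<lambda>x. Re (c * zc a b x ^ n)) x :> vc a b (c * (of_nat n * zc a b x ^ (n - 1)))" for x
    unfolding gderiv_def inner_vc
    by (rule derivative_eq_intros dz refl)+ (simp add: algebra_simps)
  show "((\<lambda>x. vc a b (c * (of_nat n * zc a b x ^ (n - 1)))) has_derivative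
      (\<lambda>h. vc a b (c * (of_nat n * (of_nat (n - 1) * (zc a b h * zc a b x ^ (n - 1 - 1))))))) (at x)" for x
    by (rule bounded_linear.has_derivative[OF bounded_linear_vc])
      ((rule derivative_eq_intros dz refl)+, simp add: algebra_simps)
  show "continuous_on UNIV (\<lambda>x. vc a b (c * (of_nat n * (of_nat (n - 1) * (zc a b h * zc a b x ^ (n - 1 - 1))))))" for h
    by (intro continuous_intros)
  show "(\<Sum>e\<in>Basis. vc a b (c * (of_nat n * (of_nat (n - 1) * (zc a b e * zc a b x ^ (n - 1 - 1))))) \<bullet> e) = 0" for x
  proof -
    \<comment> \<open>This sum is \<open>|a|^2 - |b|^2 + 2 \<i> (a \<bullet> b)\<close>; the trace
      of the Hessian is the real part of a multiple of it.\<close>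
    have "(\<Sum>e\<in>Basis. zc a b e * zc a b e) =
        of_real (\<Sum>e\<in>Basis. (a \<bullet> e) * (a \<bullet> e)) - of_real (\<Sum>e\<in>Basis. (b \<bullet> e) * (b \<bullet> e))
        + 2 * \<i> * of_real (\<Sum>e\<in>Basis. (a \<bullet> e) * (b \<bullet> e))"
      by (simp add: zc_def inner_commute algebra_simps sum.distrib sum_subtractf sum_negf sum_distrib_left)
    also have "\<dots> = 0"
      using assms by (simp add: norm_eq_1 flip: euclidean_inner)
    finally have "(\<Sum>e\<in>Basis. zc a b e * zc a b e) = 0" .
    moreover have "vc a b (c * (of_nat n * (of_nat (n - 1) * (zc a b e * zc a b x ^ (n - 1 - 1))))) \<bullet> e =
        Re (c * of_nat n * of_nat (n - 1) * zc a b x ^ (n - 1 - 1) * (zc a b e * zc a b e))" for e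
      by (simp only: inner_commute[of "vc a b v" e for v] inner_vc mult_ac)
    ultimately show ?thesis
      by (simp only: flip: Re_sum sum_distrib_left) simp
  qed
qed

text \<open>
  On the unit sphere \<open>peak_field a b P\<close> is the gradient of the exterior harmonic function
  \<open>Re (P (z x / |x|^2)) / |x|\<close>, where \<open>z x = x \<bullet> a + \<i> (x \<bullet> b)\<close>.
\<close>

definition peak_field :: "real^3 \<Rightarrow> real^3 \<Rightarrow> complex poly \<Rightarrow> real^3 \<Rightarrow> real^3" where
  "peak_field a b P x = vc a b (poly (pderiv P) (zc a b x)) -
     Re (poly P (zc a b x) + 2 * zc a b x * poly (pderiv P) (zc a b x)) *\<^sub>R x"

lemma peak_field_sum: "peak_field a b (\<Sum>i\<in>I. P i) x = (\<Sum>i\<in>I. peak_field a b (P i) x)"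
proof (induction I rule: infinite_finite_induct)
  case (insert i I)
  then show ?case
    by (simp add: peak_field_def pderiv_add linear_add[OF bounded_linear.linear[OF bounded_linear_vc]] algebra_simps)
qed (simp_all add: peak_field_def vc_def pderiv_0)

text \<open>The real parts make the field real-linear in \<open>P\<close>; a factor
  \<open>\<i>\<close> in general yields a genuinely different field.\<close>

lemma peak_field_smult: "peak_field a b (smult (of_real t) P) x = t *\<^sub>R peak_field a b P x"
  by (simp add: peak_field_def pderiv_smult vc_def algebra_simps)

lemma continuous_on_peak_field: "continuous_on X (peak_field a b P)"
  unfolding peak_field_def[abs_def] by (intro continuous_intros)

text \<open>Brings a single power into the form treated by \<open>harmonic_jet_G_int\<close>, with
  the jet of \<open>harmonic_jet_power\<close>.\<close>

lemma peak_field_monom: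
  "peak_field a b (monom c n) x = vc a b (c * (of_nat n * zc a b x ^ (n - 1))) -
     ((2 * real n + 1) * Re (c * zc a b x ^ n)) *\<^sub>R x"
proof -
  have "zc a b x * (of_nat n * zc a b x ^ (n - 1)) = of_nat n * zc a b x ^ n"
    by (cases n) simp_all
  then have "c * zc a b x ^ n + 2 * zc a b x * (of_nat n * c * zc a b x ^ (n - 1)) =
      of_real (2 * real n + 1) * (c * zc a b x ^ n)"
    by (simp add: algebra_simps)
  then have "Re (c * zc a b x ^ n + 2 * zc a b x * (of_nat n * c * zc a b x ^ (n - 1))) =
      (2 * real n + 1) * Re (c * zc a b x ^ n)"
    by (simp only: scaleR_conv_of_real[symmetric] scaleR_complex.sel)
  then show ?thesis
    by (simp add: peak_field_def pderiv_monom poly_monom mult_ac)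
qed

text \<open>Each monomial of \<open>P\<close> contributes a finite combination of the
  \<open>G_int Y n k\<close> of its own degree, and the field is additive in
  \<open>P\<close>.\<close>

lemma peak_field_in_Hardy_minus:
  assumes Y: "spherical_harmonic_basis Y" and ab: "norm a = 1" "norm b = 1" "a \<bullet> b = 0"
  shows "peak_field a b P \<in> Hardy_minus Y"
proof -
  have "\<exists>c. \<forall>x\<in>unit_sphere. peak_field a b (monom (coeff P n) n) x =
      (\<Sum>k\<in>{- int n..int n}. c k *\<^sub>R G_int Y n k x)" for n
    by (rule harmonic_jet_G_int[OF Y harmonic_jet_power[OF ab, of n "coeff P n"]])
      (auto simp: peak_field_monom)
  then have "\<exists>c. \<forall>n. \<forall>x\<in>unit_sphere. peak_field a b (monom (coeff P n) n) x =
      (\<Sum>k\<in>{- int n..int n}. c n k *\<^sub>R G_int Y n k x)"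
    by (intro choice allI)
  then obtain c where c: "\<forall>n. \<forall>x\<in>unit_sphere. peak_field a b (monom (coeff P n) n) x =
      (\<Sum>k\<in>{- int n..int n}. c n k *\<^sub>R G_int Y n k x)" ..
  define F where "F = (SIGMA n:{..degree P}. {- int n..int n})"
  define g where "g = (\<lambda>(n, k). G_int Y n k)"
  define e where "e = (\<lambda>(n, k). c n k)"
  have expansion: "peak_field a b P x = (\<Sum>i\<in>F. e i *\<^sub>R g i x)" if x: "x \<in> unit_sphere" for x
  proof -
    have "peak_field a b P x = peak_field a b (\<Sum>n\<le>degree P. monom (coeff P n) n) x"
      by (simp only: poly_as_sum_of_monoms)
    also have "\<dots> = (\<Sum>n\<le>degree P. peak_field a b (monom (coeff P n) n) x)"
      by (rule peak_field_sum)
    also have "\<dots> = (\<Sum>n\<le>degree P. \<Sum>k\<in>{- int n..int n}. e (n, k) *\<^sub>R g (n, k) x)"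
      by (rule sum.cong[OF refl]) (simp add: c[rule_format, OF x] e_def g_def)
    also have "\<dots> = (\<Sum>(n, k)\<in>F. e (n, k) *\<^sub>R g (n, k) x)"
      unfolding F_def by (rule sum.Sigma) auto
    finally show ?thesis by (simp only: split_def prod.collapse)
  qed
  \<comment> \<open>The error vanishes on the sphere, so one finite combination serves every
    \<epsilon>.\<close>
  have "L2_norm \<sigma> (\<lambda>x. peak_field a b P x - (\<Sum>i\<in>F. e i *\<^sub>R g i x)) = (0::real)"
  proof -
    have "(\<integral>x. (norm (peak_field a b P x - (\<Sum>i\<in>F. e i *\<^sub>R g i x)))\<^sup>2 \<partial>\<sigma>) = (\<integral>x. 0 \<partial>\<sigma>)"
      by (rule Bochner_Integration.integral_cong[OF refl]) (simp add: expansion)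
    then show ?thesis by (simp add: L2_norm_def)
  qed
  moreover have "finite F" "F \<subseteq> harmonic_indices 0"
    by (auto simp: F_def harmonic_indices_def)
  ultimately show ?thesis
    unfolding Hardy_minus_def L2_closed_span_def mem_Collect_eq g_def[symmetric]
    by (intro conjI L2_space_\<sigma>[OF continuous_on_peak_field] allI impI exI[of _ F] exI[of _ e]) auto
qed

section \<open>The vanishing external part\<close>

lemma gradient_zero [simp]: "gradient (\<lambda>x. 0) = (\<lambda>x. 0)"
  by (rule ext, rule gradient_eqI) (rule GDERIV_const)

text \<open>Allows the stability estimate to be tested on internal fields alone. Potential, trace
  and approximants are all 0.\<close>

lemma zero_in_Hardy_plus_altitude: "(\<lambda>x. 0) \<in> Hardy_plus_altitude \<alpha> r"
proof -
  have L2: "(\<lambda>x. 0) \<in> L2_space M" for M :: "(real^3) measure"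
    by (simp add: L2_space_def)
  have norm: "L2_norm M (\<lambda>x. 0) = 0" for M :: "(real^3) measure"
    by (simp add: L2_norm_def)
  have C1: "C1_on S (\<lambda>x::real^3. 0)" for S
    by (simp add: C1_on_def)
  have "harmonic_on (ball 0 r) (\<lambda>x::real^3. 0)"
    using C1 by (simp add: harmonic_on_def C2_on_def laplacian_def)
  moreover have "nt_maximal \<alpha> r (\<lambda>x. 0) x = 0" for x
    \<comment> \<open>Over an empty region the supremum is the least element of
      \<open>ennreal\<close>, which is 0.\<close>
    by (cases "nt_region \<alpha> r x = {}") (simp_all add: nt_maximal_def bot_ennreal)
  moreover have "(\<lambda>x. 0) \<in> H1_sphere r"
  proof -
    have "radial_extension r (\<lambda>x. 0) = (\<lambda>x. 0)"
      by (simp add: radial_extension_def fun_eq_iff)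
    then have "C1_on (- {0}) (radial_extension r (\<lambda>x. 0))" "surface_gradient r (\<lambda>x. 0) x = 0" for x
      using C1 by (simp_all add: surface_gradient_def)
    then show ?thesis
      unfolding H1_sphere_def mem_Collect_eq
      by (intro conjI L2 bexI[of _ "\<lambda>x. 0"] allI impI exI[of _ "\<lambda>x. 0"]) (simp_all add: norm)
  qed
  moreover have "nt_trace \<alpha> r (\<lambda>x. 0) (\<lambda>x. 0)"
    by (simp add: nt_trace_def)
  ultimately show ?thesis
    unfolding Hardy_plus_altitude_def mem_Collect_eq
    by (intro conjI L2 exI[of _ "\<lambda>x. 0"]) auto
qed

section \<open>Pointwise bounds for the peaking fields\<close>

text \<open>\<open>vc\<close> preserves norms and \<open>zc a b x\<close> lies in the closed unit
  disc. The factor 3 is 1 from the \<open>vc\<close> term and 2 from the radial term.\<close>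

lemma norm_peak_field_le:
  assumes ab: "norm a = 1" "norm b = 1" "a \<bullet> b = 0" and x: "norm x = 1"
  shows "norm (peak_field a b P x) \<le> 3 * cmod (poly (pderiv P) (zc a b x)) + cmod (poly P (zc a b x))"
proof -
  let ?g' = "poly (pderiv P) (zc a b x)" and ?z = "zc a b x"
  have z: "cmod ?z \<le> 1" using cmod_zc_le[OF ab, of x] x by simp
  have "norm (peak_field a b P x) \<le> cmod ?g' + \<bar>Re (poly P ?z + 2 * ?z * ?g')\<bar>"
    unfolding peak_field_def using norm_triangle_ineq4 by (rule order_trans) (simp add: norm_vc[OF ab] x)
  also have "\<bar>Re (poly P ?z + 2 * ?z * ?g')\<bar> \<le> cmod (poly P ?z) + 2 * (cmod ?z * cmod ?g')"
    using abs_Re_le_cmod[of "poly P ?z + 2 * ?z * ?g'"] norm_triangle_ineq[of "poly P ?z" "2 * ?z * ?g'"]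
    by (simp add: norm_mult)
  also have "cmod ?z * cmod ?g' \<le> cmod ?g'"
    using z by (intro mult_left_le_one_le) auto
  finally show ?thesis by simp
qed

text \<open>The radial component is minus the real part of the derivative of
  \<open>z * poly P z\<close> at \<open>zc a b x\<close>; it supplies the lower bound on the
  field.\<close>

lemma inner_peak_field:
  assumes "norm x = 1"
  shows "x \<bullet> peak_field a b P x = - Re (poly P (zc a b x) + zc a b x * poly (pderiv P) (zc a b x))"
  using assms by (simp add: peak_field_def inner_diff_right inner_vc norm_eq_1 algebra_simps)

text \<open>Multiplying by \<open>1\<close> and by \<open>\<i>\<close> recovers both parts of a complex quantity of unknown phase.\<close>

lemma norm_peak_field_ge:
  assumes "norm x = 1"
  shows "(cmod (poly P (zc a b x) + zc a b x * poly (pderiv P) (zc a b x)))\<^sup>2 \<le>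
    (norm (peak_field a b P x))\<^sup>2 + (norm (peak_field a b (smult \<i> P) x))\<^sup>2"
proof -
  have le: "(x \<bullet> y)\<^sup>2 \<le> (norm y)\<^sup>2" for y
    using Cauchy_Schwarz_ineq[of x y] assms by (simp add: norm_eq_1 power2_norm_eq_inner)
  have "(cmod (poly P (zc a b x) + zc a b x * poly (pderiv P) (zc a b x)))\<^sup>2 =
      (x \<bullet> peak_field a b P x)\<^sup>2 + (x \<bullet> peak_field a b (smult \<i> P) x)\<^sup>2"
    unfolding cmod_power2 inner_peak_field[OF assms]
    by (simp add: pderiv_smult power2_eq_square algebra_simps)
  also have "\<dots> \<le> (norm (peak_field a b P x))\<^sup>2 + (norm (peak_field a b (smult \<i> P) x))\<^sup>2"
    by (intro add_mono le)
  finally show ?thesis .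
qed

section \<open>From a modulus of continuity to a linear bound\<close>

lemma measure_\<sigma>_space: "measure \<sigma> (space \<sigma>) = 4 * pi"
  by (simp add: measure_def emeasure_sphere_measure_sphere)

lemma L2_norm_restrict_le:
  assumes f: "continuous_on unit_sphere f" and U: "openin (top_of_set unit_sphere) U"
    and B: "\<And>x. x \<in> U \<Longrightarrow> norm (f x) \<le> B" "B \<ge> 0"
  shows "L2_norm (restrict_space \<sigma> U) f \<le> B * sqrt (4 * pi)"
proof -
  have U': "U \<in> sets \<sigma>" using sets_\<sigma>_openin[OF U] .
  have int: "integrable \<sigma> (\<lambda>x. (norm (f x))\<^sup>2)" by (intro integrable_\<sigma> continuous_intros f)
  have "(\<integral>x. (norm (f x))\<^sup>2 \<partial>restrict_space \<sigma> U) = (\<integral>x. indicator U x *\<^sub>R (norm (f x))\<^sup>2 \<partial>\<sigma>)"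
    using U' sets.sets_into_space[OF U'] by (intro integral_restrict_space) (simp add: Int_absorb2)
  also have "\<dots> \<le> (\<integral>x. B\<^sup>2 \<partial>\<sigma>)"
  proof (rule integral_mono)
    show "integrable \<sigma> (\<lambda>x. indicator U x *\<^sub>R (norm (f x))\<^sup>2)"
      using U' int by (rule integrable_mult_indicator)
    show "integrable \<sigma> (\<lambda>x. B\<^sup>2)" by (intro integrable_\<sigma> continuous_intros)
    show "indicator U x *\<^sub>R (norm (f x))\<^sup>2 \<le> B\<^sup>2" for x
      using B by (auto simp: indicator_def intro!: power_mono)
  qed
  also have "\<dots> = 4 * pi * B\<^sup>2" using measure_\<sigma>_space by simp
  finally have "L2_norm (restrict_space \<sigma> U) f \<le> sqrt (4 * pi * B\<^sup>2)"
    unfolding L2_norm_def by (rule real_sqrt_le_mono)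
  also have "\<dots> = B * sqrt (4 * pi)"
    using B(2) by (simp add: real_sqrt_mult)
  finally show ?thesis .
qed

text \<open>
  Since \<open>Hardy_minus\<close> is a linear space, a modulus of continuity turns into a linear bound by scaling.
\<close>

lemma linear_stability:
  assumes Y: "spherical_harmonic_basis Y" and U: "openin (top_of_set unit_sphere) U"
    and ab: "norm a = 1" "norm b = 1" "a \<bullet> b = 0"
    and \<Phi>: "continuous_on {0..} \<Phi>" "(\<Phi> \<longlongrightarrow> 0) (at_right 0)"
    and stable: "\<And>f. f \<in> Hardy_minus Y \<Longrightarrow> L2_norm \<sigma> f \<le> \<Phi> (L2_norm (restrict_space \<sigma> U) f)"
  obtains C where "C > 0"
    "\<And>P B. B > 0 \<Longrightarrow> (\<And>x. x \<in> U \<Longrightarrow> norm (peak_field a b P x) \<le> B) \<Longrightarrow>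
       (\<integral>x. (norm (peak_field a b P x))\<^sup>2 \<partial>\<sigma>) \<le> C * B\<^sup>2"
proof -
  \<comment> \<open>Continuity at 0 and the limit from the right force \<open>\<Phi> 0 = 0\<close>,
    which covers fields that vanish on \<open>U\<close>.\<close>
  have "(\<Phi> \<longlongrightarrow> \<Phi> 0) (at 0 within {0..})"
    using \<Phi>(1) by (auto simp: continuous_on_def)
  then have "(\<Phi> \<longlongrightarrow> \<Phi> 0) (at_right 0)"
    by (rule tendsto_within_subset) auto
  then have \<Phi>0: "\<Phi> 0 = 0"
    using \<Phi>(2) by (intro tendsto_unique[of "at_right (0::real)"]) auto
  have "eventually (\<lambda>t. \<Phi> t < 1) (at_right 0)"
    using order_tendstoD(2)[OF \<Phi>(2), of 1] by simp
  then obtain \<delta>' where \<delta>': "\<delta>' > 0" "\<And>t. 0 < t \<Longrightarrow> t < \<delta>' \<Longrightarrow> \<Phi> t < 1"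
    unfolding eventually_at_right_field by auto
  define \<delta> where "\<delta> = \<delta>' / 2"
  have \<delta>: "\<delta> > 0" "\<And>t. 0 \<le> t \<Longrightarrow> t \<le> \<delta> \<Longrightarrow> \<Phi> t \<le> 1"
  proof -
    show "\<delta> > 0" using \<delta>'(1) by (simp add: \<delta>_def)
    show "\<Phi> t \<le> 1" if "0 \<le> t" "t \<le> \<delta>" for t
      using \<delta>'(1) \<delta>'(2)[of t] that \<Phi>0 by (cases "t = 0") (auto simp: \<delta>_def)
  qed
  show ?thesis
  proof (rule that[of "4 * pi / \<delta>\<^sup>2"])
    show "4 * pi / \<delta>\<^sup>2 > 0" using \<delta> by simp
    fix P B assume B: "B > 0" "\<And>x. x \<in> U \<Longrightarrow> norm (peak_field a b P x) \<le> B"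
    \<comment> \<open>Scaling by this \<open>t\<close> brings the norm on \<open>U\<close> down to
      at most \<delta>, the area of the sphere being \<open>4 * pi\<close>.\<close>
    define t where "t = \<delta> / (B * sqrt (4 * pi))"
    have t: "t > 0" using B \<delta> by (simp add: t_def)
    have peak_field_t: "peak_field a b (smult (of_real t) P) = (\<lambda>x. t *\<^sub>R peak_field a b P x)"
      by (simp add: fun_eq_iff peak_field_smult)
    have "L2_norm (restrict_space \<sigma> U) (peak_field a b (smult (of_real t) P)) \<le> (t * B) * sqrt (4 * pi)"
      using B t by (intro L2_norm_restrict_le continuous_on_peak_field U)
        (auto simp: peak_field_t intro!: mult_left_mono)
    also have "\<dots> = \<delta>" using B by (simp add: t_def)
    finally have "\<Phi> (L2_norm (restrict_space \<sigma> U) (peak_field a b (smult (of_real t) P))) \<le> 1"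
      by (intro \<delta>) (auto simp: L2_norm_def intro!: Bochner_Integration.integral_nonneg)
    then have "L2_norm \<sigma> (peak_field a b (smult (of_real t) P)) \<le> 1"
      using stable[OF peak_field_in_Hardy_minus[OF Y ab]] by (rule order_trans[rotated])
    then have "(\<integral>x. t\<^sup>2 * (norm (peak_field a b P x))\<^sup>2 \<partial>\<sigma>) \<le> 1"
      by (simp add: L2_norm_def peak_field_t power_mult_distrib)
    then have "t\<^sup>2 * (\<integral>x. (norm (peak_field a b P x))\<^sup>2 \<partial>\<sigma>) \<le> 1"
      by simp
    then have "(\<integral>x. (norm (peak_field a b P x))\<^sup>2 \<partial>\<sigma>) \<le> 1 / t\<^sup>2"
      using t by (simp add: field_simps)
    also have "\<dots> = 4 * pi / \<delta>\<^sup>2 * B\<^sup>2"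
      using \<delta> B by (simp add: t_def power_divide power_mult_distrib)
    finally show "(\<integral>x. (norm (peak_field a b P x))\<^sup>2 \<partial>\<sigma>) \<le> 4 * pi / \<delta>\<^sup>2 * B\<^sup>2" .
  qed
qed

section \<open>Concentration at a point away from the patch\<close>

text \<open>Writing the exponent as \<open>Suc M\<close> leaves the plain power \<open>M\<close> in
  the derivative.\<close>

lemma poly_peak:
  fixes z :: complex
  shows "poly ([:1/2, 1/2:] ^ Suc M) z = ((1 + z) / 2) ^ Suc M"
    and "poly (pderiv ([:1/2, 1/2:] ^ Suc M)) z = of_nat (Suc M) / 2 * ((1 + z) / 2) ^ M"
proof -
  have base: "poly [:1/2, 1/2:] z = (1 + z) / 2"
    by (simp add: add_divide_distrib)
  have deriv: "pderiv [:1/2, 1/2 :: complex:] = [:1/2:]"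
    by (simp add: pderiv_pCons)
  show "poly ([:1/2, 1/2:] ^ Suc M) z = ((1 + z) / 2) ^ Suc M"
    by (simp only: poly_power base)
  show "poly (pderiv ([:1/2, 1/2:] ^ Suc M)) z = of_nat (Suc M) / 2 * ((1 + z) / 2) ^ M"
    unfolding pderiv_power_Suc poly_mult poly_smult poly_power base deriv by simp
qed

theorem corollary12:
  fixes Y :: "nat \<Rightarrow> int \<Rightarrow> real^3 \<Rightarrow> real"
    and U :: "(real^3) set"
    and r \<alpha> :: real
  assumes "spherical_harmonic_basis Y"
    and "patch U"
    and "r > 1"
    and "\<alpha> > 0"
  shows "\<not> (\<exists>\<Phi> :: real \<Rightarrow> real.
     continuous_on {0..} \<Phi> \<and> \<Phi> ` {0..} \<subseteq> {0..} \<and> (\<Phi> \<longlongrightarrow> 0) (at_right 0) \<and>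
     (\<forall>f\<^sub>p \<in> Hardy_plus_altitude \<alpha> r. \<forall>f\<^sub>m \<in> Hardy_minus Y.
        L2_norm (sphere_measure 1) f\<^sub>p + L2_norm (sphere_measure 1) f\<^sub>m
          \<le> \<Phi> (L2_norm (restrict_space (sphere_measure 1) U) (\<lambda>x. f\<^sub>p x + f\<^sub>m x))))"
proof (rule notI, elim exE conjE)
  fix \<Phi> :: "real \<Rightarrow> real"
  assume \<Phi>: "continuous_on {0..} \<Phi>" "(\<Phi> \<longlongrightarrow> 0) (at_right 0)"
    and stable: "\<forall>f\<^sub>p \<in> Hardy_plus_altitude \<alpha> r. \<forall>f\<^sub>m \<in> Hardy_minus Y.
      L2_norm \<sigma> f\<^sub>p + L2_norm \<sigma> f\<^sub>m \<le> \<Phi> (L2_norm (restrict_space \<sigma> U) (\<lambda>x. f\<^sub>p x + f\<^sub>m x))"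
  have stable_minus: "L2_norm \<sigma> f \<le> \<Phi> (L2_norm (restrict_space \<sigma> U) f)" if "f \<in> Hardy_minus Y" for f
    using stable[rule_format, OF zero_in_Hardy_plus_altitude that] by (simp add: L2_norm_def)
  have U: "openin (top_of_set unit_sphere) U" and "unit_sphere - closure U \<noteq> {}"
    using assms(2) by (auto simp: patch_def)
  then obtain v where v: "norm v = 1" "v \<notin> closure U"
    by (metis Diff_iff ex_in_conv mem_sphere_0)
  then obtain d0 where d0: "d0 > 0" "\<And>x. x \<in> U \<Longrightarrow> dist x v \<ge> d0"
    unfolding closure_approachable by (meson not_less)
  \<comment> \<open>The cap at 1 gives \<open>q\<^sup>2 \<ge> 3 / 4\<close> below, which keeps
    \<open>K\<close> close to \<open>v\<close>.\<close>
  define d where "d = min d0 1"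
  have d: "0 < d" "d \<le> 1" "\<And>x. x \<in> U \<Longrightarrow> dist x v \<ge> d"
    using d0 by (auto simp: d_def min_le_iff_disj)
  obtain y :: "real^3" where y: "y \<noteq> 0" "orthogonal v y"
    using orthogonal_to_vector_exists[of v] by auto
  define b where "b = y /\<^sub>R norm y"
  have ab: "norm v = 1" "norm b = 1" "v \<bullet> b = 0"
    using v y by (auto simp: b_def orthogonal_def)
  obtain C where C: "C > 0" and bound: "\<And>P B. B > 0 \<Longrightarrow>
      (\<And>x. x \<in> U \<Longrightarrow> norm (peak_field v b P x) \<le> B) \<Longrightarrow> (\<integral>x. (norm (peak_field v b P x))\<^sup>2 \<partial>\<sigma>) \<le> C * B\<^sup>2"
    using linear_stability[OF assms(1) U ab \<Phi> stable_minus] by blast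
  define w where "w x = (1 + zc v b x) / 2" for x
  \<comment> \<open>For unit \<open>x\<close>, \<open>|w x|^2\<close> is at most
    \<open>(1 + x \<bullet> v) / 2 = 1 - |x - v|^2 / 4\<close>, so \<open>q\<close> bounds
    \<open>|w|\<close> on \<open>U\<close>. The midpoint \<open>q'\<close> of \<open>q\<close> and 1
    leaves room for a neighbourhood of \<open>v\<close> on which \<open>|w|\<close> exceeds
    \<open>q'\<close>.\<close>
  define q where "q = sqrt (1 - d\<^sup>2 / 4)"
  define q' where "q' = (1 + q) / 2"
  have "d\<^sup>2 \<le> 1" using d by (simp add: power_le_one)
  then have q_sq: "q\<^sup>2 = 1 - d\<^sup>2 / 4" by (simp add: q_def)
  have "0 < q" "q < 1"
    using \<open>d\<^sup>2 \<le> 1\<close> d by (auto simp: q_def)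
  then have q': "q < q'" "q' < 1" "0 < q'" by (auto simp: q'_def)
  have w_sq: "(cmod (w x))\<^sup>2 \<le> (1 + x \<bullet> v) / 2" if "norm x = 1" for x
  proof -
    have Re_z: "Re (zc v b x) = x \<bullet> v" by (simp add: zc_def)
    have "(cmod (zc v b x))\<^sup>2 \<le> 1"
      using cmod_zc_le[OF ab, of x] that by (simp add: power_le_one)
    then have "(x \<bullet> v)\<^sup>2 + (Im (zc v b x))\<^sup>2 \<le> 1"
      by (simp add: cmod_power2 Re_z)
    moreover have "(cmod (w x))\<^sup>2 = (1 + 2 * (x \<bullet> v) + ((x \<bullet> v)\<^sup>2 + (Im (zc v b x))\<^sup>2)) / 4"
      unfolding w_def norm_divide power_divide cmod_power2[of "1 + zc v b x"]
      by (simp add: Re_z power2_sum)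
    ultimately show ?thesis by simp
  qed
  have w_le_1: "cmod (w x) \<le> 1" if "norm x = 1" for x
  proof -
    have "cmod (1 + zc v b x) \<le> 2"
      using norm_triangle_ineq[of 1 "zc v b x"] cmod_zc_le[OF ab, of x] that by simp
    then show ?thesis by (simp add: w_def norm_divide)
  qed
  have U_sphere: "norm x = 1" if "x \<in> U" for x
    using openin_imp_subset[OF U] that by auto
  have w_le_q: "cmod (w x) \<le> q" if "x \<in> U" for x
  proof (rule power2_le_imp_le)
    have "d\<^sup>2 \<le> (dist x v)\<^sup>2" using d that by (intro power_mono) auto
    also have "\<dots> = 2 - 2 * (x \<bullet> v)"
      using U_sphere[OF that] v by (simp add: dist_norm power2_norm_eq_inner inner_diff_left
          inner_diff_right inner_commute norm_eq_1)
    finally show "(cmod (w x))\<^sup>2 \<le> q\<^sup>2"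
      using w_sq[OF U_sphere[OF that]] by (simp add: q_sq)
  qed (use \<open>0 < q\<close> in simp)
  define K where "K = unit_sphere \<inter> {x. q' < cmod (w x)}"
  have K: "openin (top_of_set unit_sphere) K"
    unfolding K_def w_def
    by (intro openin_open_Int open_Collect_less continuous_intros) auto
  have "zc v b v = 1" using ab by (simp add: zc_def norm_eq_1)
  then have "v \<in> K" using v q' by (simp add: K_def w_def)
  define m where "m = measure \<sigma> K"
  have "m > 0"
    using emeasure_\<sigma>_openin_pos[OF K] \<open>v \<in> K\<close> finite_measure.emeasure_eq_measure[OF finite_measure_\<sigma>, of K]
    by (auto simp: m_def)
  \<comment> \<open>The linear bound compares the mass on \<open>K\<close>, of order at least
    \<open>q' ^ (2 * M)\<close>, with the square of the bound on \<open>U\<close>. The constant 18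
    is 2 for the pair \<open>P\<close>, \<open>smult \<i> P\<close> times \<open>3\<^sup>2\<close>
    from \<open>B\<close>; the 4 comes from the halved lower bound.\<close>
  have main: "m / 4 \<le> 18 * C * (real (Suc M) * (q / q') ^ M)\<^sup>2" for M
  proof -
    define P :: "complex poly" where "P = [:1/2, 1/2:] ^ Suc M"
    define B where "B = 3 * real (Suc M) * q ^ M"
    have P: "poly P (zc v b x) = w x ^ Suc M"
      "poly (pderiv P) (zc v b x) = of_nat (Suc M) / 2 * w x ^ M" for x
      unfolding P_def poly_peak w_def by simp_all
    have upper: "3 * cmod (poly (pderiv P) (zc v b x)) + cmod (poly P (zc v b x)) \<le> B" if "x \<in> U" for x
    proof -
      have "cmod (w x) ^ M \<le> q ^ M" using w_le_q[OF that] by (intro power_mono) auto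
      moreover have "cmod (w x) ^ Suc M \<le> cmod (w x) ^ M"
        using w_le_1[OF U_sphere[OF that]] by (intro power_decreasing) auto
      ultimately have "3 * (real (Suc M) / 2 * cmod (w x) ^ M) + cmod (w x) ^ Suc M \<le>
          3 * (real (Suc M) / 2 * q ^ M) + q ^ M"
        by (intro add_mono mult_left_mono) auto
      also have "\<dots> \<le> B"
      proof -
        have "q ^ M \<le> real (Suc M) * q ^ M" using \<open>0 < q\<close> by simp
        moreover have "0 \<le> real (Suc M) * q ^ M" using \<open>0 < q\<close> by simp
        ultimately show ?thesis unfolding B_def by linarith
      qed
      finally show ?thesis
        by (simp add: P norm_mult norm_divide norm_power del: of_nat_Suc power_Suc)
    qed
    have "B > 0" using \<open>0 < q\<close> by (simp add: B_def)
    have b1: "(\<integral>x. (norm (peak_field v b P x))\<^sup>2 \<partial>\<sigma>) \<le> C * B\<^sup>2"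
    proof (rule bound[OF \<open>B > 0\<close>])
      fix x assume "x \<in> U"
      then show "norm (peak_field v b P x) \<le> B"
        using norm_peak_field_le[OF ab U_sphere, of x P] upper by force
    qed
    have b2: "(\<integral>x. (norm (peak_field v b (smult \<i> P) x))\<^sup>2 \<partial>\<sigma>) \<le> C * B\<^sup>2"
    proof (rule bound[OF \<open>B > 0\<close>])
      fix x assume "x \<in> U"
      then show "norm (peak_field v b (smult \<i> P) x) \<le> B"
        using norm_peak_field_le[OF ab U_sphere, of x "smult \<i> P"] upper[of x]
        by (simp add: pderiv_smult norm_mult)
    qed
    have lower: "(q' ^ M / 2)\<^sup>2 \<le> (norm (peak_field v b P x))\<^sup>2 + (norm (peak_field v b (smult \<i> P) x))\<^sup>2" if "x \<in> K" for x
    proof -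
      have x: "norm x = 1" "q' < cmod (w x)" using that by (auto simp: K_def)
      \<comment> \<open>On \<open>K\<close> the modulus of \<open>w x\<close> exceeds
        \<open>q\<close>, so \<open>w_sq\<close> forces \<open>x \<bullet> v\<close> to be at least
        \<open>1 / 2\<close>.\<close>
      have "3 / 4 \<le> q\<^sup>2" using \<open>d\<^sup>2 \<le> 1\<close> by (simp add: q_sq)
      also have "\<dots> \<le> (cmod (w x))\<^sup>2" using x q' \<open>0 < q\<close> by (intro power_mono) auto
      also note w_sq[OF x(1)]
      finally have xv: "x \<bullet> v \<ge> 1 / 2" by simp
      \<comment> \<open>The derivative of \<open>z * poly P z\<close> factors as
        \<open>w x ^ M * s\<close>; positivity of \<open>x \<bullet> v\<close> prevents the two
        terms of \<open>s\<close> from cancelling.\<close>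
      define s where "s = w x + zc v b x * (of_nat (Suc M) / 2)"
      have "Re s = 1 / 2 + (x \<bullet> v) / 2 + (x \<bullet> v) * (real (Suc M) / 2)"
        by (simp add: s_def w_def zc_def add_divide_distrib del: of_nat_Suc)
      moreover have "0 \<le> (x \<bullet> v) * (real (Suc M) / 2)" using xv by simp
      ultimately have "1 / 2 \<le> Re s" using xv by linarith
      then have "1 / 2 \<le> cmod s" using complex_Re_le_cmod[of s] by linarith
      moreover have "q' ^ M \<le> cmod (w x) ^ M" using x q' by (intro power_mono) auto
      ultimately have "q' ^ M * (1 / 2) \<le> cmod (w x) ^ M * cmod s"
        using q' by (intro mult_mono) auto
      also have "\<dots> = cmod (poly P (zc v b x) + zc v b x * poly (pderiv P) (zc v b x))"
        by (simp add: P s_def algebra_simps del: of_nat_Suc flip: norm_power norm_mult)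
      finally have "(q' ^ M / 2)\<^sup>2 \<le> (cmod (poly P (zc v b x) + zc v b x * poly (pderiv P) (zc v b x)))\<^sup>2"
        using q' by (intro power_mono) auto
      then show ?thesis using norm_peak_field_ge[OF x(1)] by (rule order_trans)
    qed
    have int: "integrable \<sigma> (\<lambda>x. (norm (peak_field v b Q x))\<^sup>2)" for Q
      by (intro integrable_\<sigma> continuous_intros continuous_on_peak_field)
    have "m * (q' ^ M / 2)\<^sup>2 = (\<integral>x. indicator K x * (q' ^ M / 2)\<^sup>2 \<partial>\<sigma>)"
      using sets.sets_into_space[OF sets_\<sigma>_openin[OF K]] by (simp add: m_def Int_absorb2)
    also have "\<dots> \<le> (\<integral>x. (norm (peak_field v b P x))\<^sup>2 + (norm (peak_field v b (smult \<i> P) x))\<^sup>2 \<partial>\<sigma>)"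
    proof (rule integral_mono)
      show "integrable \<sigma> (\<lambda>x. indicator K x * (q' ^ M / 2)\<^sup>2)"
        using sets_\<sigma>_openin[OF K] finite_measure.emeasure_finite[OF finite_measure_\<sigma>]
        by (intro integrable_mult_left integrable_real_indicator) (auto simp: less_top)
      show "integrable \<sigma> (\<lambda>x. (norm (peak_field v b P x))\<^sup>2 + (norm (peak_field v b (smult \<i> P) x))\<^sup>2)"
        by (intro Bochner_Integration.integrable_add int)
      show "indicator K x * (q' ^ M / 2)\<^sup>2 \<le>
          (norm (peak_field v b P x))\<^sup>2 + (norm (peak_field v b (smult \<i> P) x))\<^sup>2" for x
        using lower[of x] by (cases "x \<in> K") auto
    qed
    also have "\<dots> \<le> 2 * C * B\<^sup>2"
      using b1 b2 by (simp add: int)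
    finally have "m / 4 * (q' ^ M)\<^sup>2 \<le> 18 * C * (real (Suc M) * q ^ M)\<^sup>2"
      by (simp add: B_def power_mult_distrib power_divide del: of_nat_Suc)
    then have "m / 4 \<le> 18 * C * (real (Suc M) * q ^ M)\<^sup>2 / (q' ^ M)\<^sup>2"
      using q' by (simp add: pos_le_divide_eq)
    then show ?thesis
      by (simp add: power_divide power_mult_distrib del: of_nat_Suc)
  qed
  \<comment> \<open>Since \<open>q < q'\<close>, geometric decay beats the linear factor
    \<open>Suc M\<close>, and the fixed positive measure \<open>m\<close> of \<open>K\<close> is
    forced to be at most 0.\<close>
  have "(\<lambda>M. real M * (q / q') ^ M + (q / q') ^ M) \<longlonglongrightarrow> 0 + 0"
    using q' \<open>0 < q\<close> powser_times_n_limit_0[of "q / q'"]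
    by (intro tendsto_add LIMSEQ_power_zero) auto
  then have "(\<lambda>M. real (Suc M) * (q / q') ^ M) \<longlonglongrightarrow> 0"
    by (simp add: algebra_simps)
  then have "(\<lambda>M. 18 * C * (real (Suc M) * (q / q') ^ M)\<^sup>2) \<longlonglongrightarrow> 18 * C * 0\<^sup>2"
    by (intro tendsto_intros)
  then have "m / 4 \<le> 18 * C * 0\<^sup>2"
    by (rule LIMSEQ_le_const) (use main in blast)
  then show False using \<open>m > 0\<close> by simp
qed

end
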